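(* The existence of a generalized torsion element is not a profinite property. That is, there exist finitely generated residually finite groups $G_1$ and $G_2$ with isomorphic profinite completions $\widehat{G_1}\cong\widehat{G_2}$ such that $G_2$ contains a generalized torsion element and $G_1$ contains no generalized torsion element.
   Context: A generalized torsion element of a group $G$ is a non-identity element $g\in G$ for which there exist an integer $k\ge 1$ and $g_1,\ldots,g_k\in G$ such that the product of conjugates $(g_1^{-1}gg_1)\cdots(g_k^{-1}gg_k)$ is trivial. The profinite completion of a group $G$ is the inverse limit $\widehat{G}=\varprojlim G/N$, where $N$ ranges over all finite index normal subgroups of $G$ (ordered by reverse inclusion, with the natural projections $G/M\to G/N$ for $N\supset M$). A property $\mathcal{P}$ of finitely generated residually finite groups is a profinite property if for any two finitely generated residually finite groups $G_1,G_2$ with $\widehat{G_1}\cong\widehat{G_2}$, $G_1$ satisfies $\mathcal{P}$ if and only if $G_2$ satisfies $\mathcal{P}$. *)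

theory Defs
  imports "HOL-Algebra.Product_Groups" "HOL-Algebra.Coset" "HOL-Analysis.Function_Topology"
begin

definition generalized_torsion_element :: "('a, 'b) monoid_scheme \<Rightarrow> 'a \<Rightarrow> bool" where
  "generalized_torsion_element G g \<longleftrightarrow>
     g \<in> carrier G \<and> g \<noteq> \<one>\<^bsub>G\<^esub> \<and>
     (\<exists>gs. length gs \<ge> 1 \<and> set gs \<subseteq> carrier G \<and>
        foldr (\<otimes>\<^bsub>G\<^esub>) (map (\<lambda>h. inv\<^bsub>G\<^esub> h \<otimes>\<^bsub>G\<^esub> g \<otimes>\<^bsub>G\<^esub> h) gs) \<one>\<^bsub>G\<^esub> = \<one>\<^bsub>G\<^esub>)"

definition has_generalized_torsion :: "('a, 'b) monoid_scheme \<Rightarrow> bool" where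
  "has_generalized_torsion G \<longleftrightarrow> (\<exists>g. generalized_torsion_element G g)"

definition finitely_generated_group :: "('a, 'b) monoid_scheme \<Rightarrow> bool" where
  "finitely_generated_group G \<longleftrightarrow>
     group G \<and> (\<exists>S. finite S \<and> S \<subseteq> carrier G \<and> generate G S = carrier G)"

definition finite_index_normal_subgroups :: "('a, 'b) monoid_scheme \<Rightarrow> 'a set set" where
  "finite_index_normal_subgroups G = {N. N \<lhd> G \<and> finite (rcosets\<^bsub>G\<^esub> N)}"

definition residually_finite_group :: "('a, 'b) monoid_scheme \<Rightarrow> bool" where
  "residually_finite_group G \<longleftrightarrow>
     group G \<and>
     (\<forall>g \<in> carrier G. g \<noteq> \<one>\<^bsub>G\<^esub> \<longrightarrow> (\<exists>N \<in> finite_index_normal_subgroups G. g \<notin> N))"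

(* For M \<subseteq> N this sends the coset M g in G/M to the coset N g in G/N;
   see quotient_projection_coset. The source subgroup M is not needed as an argument. *)
definition quotient_projection :: "('a, 'b) monoid_scheme \<Rightarrow> 'a set \<Rightarrow> 'a set \<Rightarrow> 'a set" where
  "quotient_projection G N C = N <#>\<^bsub>G\<^esub> C"

lemma quotient_projection_coset:
  assumes "M \<lhd> G" "N \<lhd> G" "M \<subseteq> N" "g \<in> carrier G"
  shows "quotient_projection G N (M #>\<^bsub>G\<^esub> g) = N #>\<^bsub>G\<^esub> g"
proof -
  have M: "subgroup M G" and N: "subgroup N G" and G: "group G"
    by (rule normal_imp_subgroup[OF assms(1)], rule normal_imp_subgroup[OF assms(2)],
        rule normal.axioms(2)[OF assms(1)])
  have "N <#>\<^bsub>G\<^esub> M = N"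
  proof
    show "N <#>\<^bsub>G\<^esub> M \<subseteq> N"
      unfolding set_mult_def using subgroup.m_closed[OF N _ subsetD[OF assms(3)]] by fast
    show "N \<subseteq> N <#>\<^bsub>G\<^esub> M"
    proof
      fix x assume x: "x \<in> N"
      have "x \<otimes>\<^bsub>G\<^esub> \<one>\<^bsub>G\<^esub> \<in> N <#>\<^bsub>G\<^esub> M"
        unfolding set_mult_def using x subgroup.one_closed[OF M] by fast
      then show "x \<in> N <#>\<^bsub>G\<^esub> M"
        by (simp only: monoid.r_one[OF group.is_monoid[OF G] subgroup.mem_carrier[OF N x]])
    qed
  qed
  moreover have "N <#>\<^bsub>G\<^esub> (M #>\<^bsub>G\<^esub> g) = (N <#>\<^bsub>G\<^esub> M) #>\<^bsub>G\<^esub> g"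
    by (rule group.setmult_rcos_assoc[OF G subgroup.subset[OF N] subgroup.subset[OF M] assms(4)])
  ultimately show ?thesis
    unfolding quotient_projection_def by (simp only:)
qed

(* The inverse limit of the G/N, realised as the compatible families inside the product
   of the finite quotients. *)
definition profinite_completion :: "('a, 'b) monoid_scheme \<Rightarrow> ('a set \<Rightarrow> 'a set) monoid" where
  "profinite_completion G =
     (product_group (finite_index_normal_subgroups G) (\<lambda>N. G Mod N))
       \<lparr>carrier := {x \<in> carrier (product_group (finite_index_normal_subgroups G) (\<lambda>N. G Mod N)).
          \<forall>M \<in> finite_index_normal_subgroups G. \<forall>N \<in> finite_index_normal_subgroups G.
            M \<subseteq> N \<longrightarrow> quotient_projection G N (x M) = x N}\<rparr>"

definition profinite_topology :: "('a, 'b) monoid_scheme \<Rightarrow> ('a set \<Rightarrow> 'a set) topology" where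
  "profinite_topology G =
     subtopology
       (product_topology (\<lambda>N. discrete_topology (carrier (G Mod N))) (finite_index_normal_subgroups G))
       (carrier (profinite_completion G))"

(* Isomorphism of profinite groups: a group isomorphism that is also a homeomorphism. *)
definition isomorphic_profinite_completions ::
  "('a, 'b) monoid_scheme \<Rightarrow> ('c, 'd) monoid_scheme \<Rightarrow> bool" where
  "isomorphic_profinite_completions G H \<longleftrightarrow>
     (\<exists>f. f \<in> iso (profinite_completion G) (profinite_completion H) \<and>
          homeomorphic_map (profinite_topology G) (profinite_topology H) f)"

(* HOL cannot quantify over types inside a formula, so the groups range over those with carrier
   in one fixed type. At type nat every finitely generated group occurs up to isomorphism,
   since finitely generated groups are countable. *)
definition profinite_property :: "('a monoid \<Rightarrow> bool) \<Rightarrow> bool" where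
  "profinite_property P \<longleftrightarrow>
     (\<forall>G1 G2.
        finitely_generated_group G1 \<and> residually_finite_group G1 \<and>
        finitely_generated_group G2 \<and> residually_finite_group G2 \<and>
        isomorphic_profinite_completions G1 G2 \<longrightarrow>
        (P G1 \<longleftrightarrow> P G2))"

end

theory Submission
  imports Defs "HOL-Library.Poly_Mapping" "HOL-Number_Theory.Residues"
begin

text \<open>
  Let \<open>E\<close> be the group of upper triangular matrices with rows \<open>(1, a, c)\<close>, \<open>(0, t\<^sup>n, b)\<close>,
  \<open>(0, 0, 1)\<close> over the Laurent polynomials \<open>R = \<int>[t, t\<^sup>-\<^sup>1]\<close>. It is generated by three matrices, and
  the matrices with only the entry \<open>c\<close> form a central copy of \<open>R\<close>. This copy has infinite rank, so
  there is great freedom in choosing an additive subgroup \<open>D\<close> of \<open>R\<close> and passing to \<open>E / D\<close>. Both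
  groups of the theorem arise in this way.

  In a finite quotient of \<open>E\<close> the exponents of \<open>t\<close> only matter modulo some \<open>e\<close>. Hence the
  completion of \<open>E\<close> admits conjugation by the diagonal matrix with entries \<open>1, 1, t\<^sup>-\<^sup>s\<close>, which shifts
  the exponents in \<open>b\<close> and \<open>c\<close> by \<open>s\<close>, for every \<^emph>\<open>profinite\<close> integer \<open>s\<close>. Take \<open>s\<close> to be \<open>-1/2\<close> at
  the prime \<open>3\<close> and \<open>0\<close> at all other primes: this shift of \<open>m\<close> turns \<open>2 m\<close>, as a \<open>3\<close>-adic
  number, into \<open>2 m - 1\<close>.

  Let \<open>D\<^sub>i\<close> (\<open>relations i\<close>, for \<open>i = 0, 1\<close>) identify \<open>t\<^sup>m\<close> with \<open>\<plusminus> t\<^sup>l\<close> whenever \<open>2 m - i\<close> and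
  \<open>2 l - i\<close> are nonzero and have the same \<open>3\<close>-adic valuation, the sign being that of the quotient
  of their unit parts modulo \<open>3\<close>. Write \<open>\<plusminus> u\<^sub>j\<close> for the class belonging to the valuation \<open>j\<close>. As
  \<open>2 m - 1\<close> never vanishes, \<open>R / D\<^sub>1\<close> is free abelian on the \<open>u\<^sub>j\<close>. In \<open>R / D\<^sub>0\<close> there is one further
  generator \<open>t\<^sup>0\<close>, which in the profinite topology is a limit of \<open>u\<^sub>j\<close> and also of \<open>- u\<^sub>j\<close>; the
  group \<open>D\<^sub>0\<close> contains \<open>2 t\<^sup>0\<close> but not \<open>t\<^sup>0\<close>. A finite quotient does not notice the difference: in
  it all \<open>\<plusminus> u\<^sub>j\<close> with large \<open>j\<close> coincide with one element \<open>\<kappa>\<close> such that \<open>2 \<kappa> = 0\<close>, whether or not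
  some \<open>t\<^sup>m\<close> sits at the limit point (\<open>periodic_normal_form\<close>). So the profinite shift carries the
  closure of \<open>D\<^sub>1\<close> onto that of \<open>D\<^sub>0\<close> (\<open>shifted_relations\<close>), and the two completions are
  isomorphic (\<open>isomorphic_completions_of_quotients\<close>).

  The element \<open>t\<^sup>0\<close> has order two in \<open>E / D\<^sub>0\<close>, so this group has generalized torsion. In \<open>E / D\<^sub>1\<close>
  suppose that \<open>k \<ge> 1\<close> conjugates of \<open>g\<close> have trivial product. Comparing the exponents \<open>n\<close> gives
  \<open>n = 0\<close>; then \<open>a\<close> and \<open>b\<close> are annihilated by a sum of \<open>k\<close> powers of \<open>t\<close>, which is not zero, and
  \<open>R\<close> is a domain; so \<open>g\<close> is central, its \<open>k\<close>-th power is trivial, and \<open>R / D\<^sub>1\<close> is torsion free.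
  Residual finiteness holds because \<open>D\<^sub>i\<close> is cut out by functionals into \<open>\<int>\<close> and \<open>\<int>/2\<close> that
  depend on the exponents periodically (\<open>separate_central_relations\<close>).
\<close>

section \<open>Isomorphisms of profinite completions from approximate homomorphisms\<close>

lemma (in group) finite_index_normalD:
  assumes "N \<in> finite_index_normal_subgroups G"
  shows "N \<lhd> G" "subgroup N G" "finite (carrier (G Mod N))"
  using assms normal_imp_subgroup
  by (auto simp: finite_index_normal_subgroups_def FactGroup_def)

lemma (in normal) coset_eq_of_mem:
  assumes "C \<in> carrier (G Mod H)" "g \<in> C"
  shows "g \<in> carrier G" "C = H #> g"
proof -
  obtain x where x: "x \<in> carrier G" "C = H #> x"
    using assms(1) by (auto simp: carrier_FactGroup)
  show g: "g \<in> carrier G"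
    using x assms(2) elemrcos_carrier is_group by blast
  show "C = H #> g"
    using x assms(2) repr_independence subgroup_axioms by blast
qed

lemma (in normal) coset_nonempty:
  assumes "C \<in> carrier (G Mod H)"
  shows "\<exists>g. g \<in> C"
  using assms rcos_self[OF _ subgroup_axioms] by (auto simp: carrier_FactGroup)

lemma (in group_hom) eq_on_kernel_coset:
  assumes C: "C \<in> carrier (G Mod kernel G H h)" and "g \<in> C" "g' \<in> C"
  shows "h g = h g'"
proof -
  interpret K: normal "kernel G H h" G by (rule normal_kernel)
  have g': "g' \<in> carrier G"
    by (rule K.coset_eq_of_mem(1)[OF C \<open>g' \<in> C\<close>])
  have "g \<in> kernel G H h #> g'"
    by (rule subst[OF K.coset_eq_of_mem(2)[OF C \<open>g' \<in> C\<close>]]) fact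
  then obtain d where d: "d \<in> carrier G" "h d = \<one>\<^bsub>H\<^esub>" "g = d \<otimes> g'"
    unfolding r_coset_def kernel_def by blast
  show ?thesis
    unfolding d(3) hom_mult[OF d(1) g'] d(2) by (rule H.l_one[OF hom_closed[OF g']])
qed

lemma (in group_hom) kernel_finite_index:
  assumes "finite (carrier H)"
  shows "kernel G H h \<in> finite_index_normal_subgroups G"
proof -
  have "(\<lambda>X. the_elem (h ` X)) ` carrier (G Mod kernel G H h) \<subseteq> carrier H"
    by (intro image_subsetI FactGroup_the_elem_mem)
  then have "finite (carrier (G Mod kernel G H h))"
    using finite_imageD[OF _ FactGroup_inj_on] finite_subset[OF _ assms] by metis
  then show ?thesis
    using normal_kernel by (simp add: finite_index_normal_subgroups_def FactGroup_def)
qed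

lemma (in group) mem_profinite_completion:
  "x \<in> carrier (profinite_completion G) \<longleftrightarrow>
     x \<in> (\<Pi>\<^sub>E N \<in> finite_index_normal_subgroups G. carrier (G Mod N)) \<and>
     (\<forall>M \<in> finite_index_normal_subgroups G. \<forall>N \<in> finite_index_normal_subgroups G.
        M \<subseteq> N \<longrightarrow> N <#> x M = x N)"
  by (simp add: profinite_completion_def quotient_projection_def)

lemma (in group) topspace_profinite_topology [simp]:
  "topspace (profinite_topology G) = carrier (profinite_completion G)"
proof -
  have "carrier (profinite_completion G)
      \<subseteq> (\<Pi>\<^sub>E N \<in> finite_index_normal_subgroups G. carrier (G Mod N))"
    by (rule subsetI) (simp add: mem_profinite_completion)
  then show ?thesis
    unfolding profinite_topology_def by (simp add: Int_absorb1)
qed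

lemma (in group) component_representative:
  assumes P: "P \<in> finite_index_normal_subgroups G" and y: "y \<in> carrier (profinite_completion G)"
  obtains g where "g \<in> carrier G" "g \<in> y P"
proof -
  have C: "y P \<in> carrier (G Mod P)"
    using y P by (auto simp: mem_profinite_completion)
  obtain g where g: "g \<in> y P"
    using normal.coset_nonempty[OF finite_index_normalD(1)[OF P] C] ..
  show thesis
    by (rule that[OF normal.coset_eq_of_mem(1)[OF finite_index_normalD(1)[OF P] C g] g])
qed

lemma (in group) component_coset:
  assumes P: "P \<in> finite_index_normal_subgroups G" and Q: "Q \<in> finite_index_normal_subgroups G"
    and PQ: "P \<subseteq> Q"
    and y: "y \<in> carrier (profinite_completion G)" and g: "g \<in> y P"
  shows "y Q = Q #> g" "g \<in> y Q"
proof -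
  have C: "y P \<in> carrier (G Mod P)"
    using y P by (auto simp: mem_profinite_completion)
  note g' = normal.coset_eq_of_mem[OF finite_index_normalD(1)[OF P] C g]
  have "y Q = Q <#> y P"
    using y P Q PQ by (simp add: mem_profinite_completion)
  also have "\<dots> = Q <#> (P #> g)"
    by (rule arg_cong[OF g'(2)])
  also have "\<dots> = Q #> g"
    using quotient_projection_coset[OF finite_index_normalD(1)[OF P] finite_index_normalD(1)[OF Q] PQ g'(1)]
    by (simp only: quotient_projection_def)
  finally show "y Q = Q #> g" .
  then show "g \<in> y Q"
    using rcos_self[OF g'(1) finite_index_normalD(2)[OF Q]] by (simp only:)
qed

text \<open>A sequence of maps need not consist of homomorphisms, nor converge, to induce a map of
  profinite completions: it suffices that modulo each finite index normal subgroup it is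
  eventually constant and eventually multiplicative, because the completion only sees one
  finite quotient at a time. This is how an element of the completion that is a limit of group
  elements can be used without ever leaving the two groups.\<close>

locale approximate_hom = G: group G + H: group H
  for G :: "('a, 'm) monoid_scheme" and H :: "('b, 'n) monoid_scheme" +
  fixes a :: "nat \<Rightarrow> 'a \<Rightarrow> 'b"
  assumes closed: "x \<in> carrier G \<Longrightarrow> a k x \<in> carrier H"
    and ev_hom: "N \<in> finite_index_normal_subgroups H \<Longrightarrow>
      \<exists>K. \<forall>k\<ge>K. \<forall>x \<in> carrier G. \<forall>y \<in> carrier G.
        N #>\<^bsub>H\<^esub> a k (x \<otimes>\<^bsub>G\<^esub> y) = N #>\<^bsub>H\<^esub> (a k x \<otimes>\<^bsub>H\<^esub> a k y)"
    and ev_const: "N \<in> finite_index_normal_subgroups H \<Longrightarrow>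
      \<exists>K. \<forall>k\<ge>K. \<forall>l\<ge>K. \<forall>x \<in> carrier G. N #>\<^bsub>H\<^esub> a k x = N #>\<^bsub>H\<^esub> a l x"
begin

text \<open>The value of the limit of the maps \<open>a k\<close> in the finite quotient by \<open>N\<close>, as a coset.\<close>

definition limit_coset :: "'b set \<Rightarrow> 'a \<Rightarrow> 'b set" where
  "limit_coset N x = (THE C. \<forall>\<^sub>F k in sequentially. N #>\<^bsub>H\<^esub> a k x = C)"

definition pullback :: "'b set \<Rightarrow> 'a set" where
  "pullback N = kernel G (H Mod N) (limit_coset N)"

definition completion_map :: "('a set \<Rightarrow> 'a set) \<Rightarrow> 'b set \<Rightarrow> 'b set" where
  "completion_map y = (\<lambda>N \<in> finite_index_normal_subgroups H.
     limit_coset N (SOME g. g \<in> y (pullback N)))"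

lemma pullback_iff: "x \<in> pullback N \<longleftrightarrow> x \<in> carrier G \<and> limit_coset N x = N"
  by (simp add: pullback_def kernel_def)

lemma limit_coset_eventually:
  assumes "N \<in> finite_index_normal_subgroups H"
  shows "\<exists>K. \<forall>k\<ge>K. \<forall>x \<in> carrier G. limit_coset N x = N #>\<^bsub>H\<^esub> a k x"
proof -
  obtain K where K: "\<forall>k\<ge>K. \<forall>l\<ge>K. \<forall>x \<in> carrier G. N #>\<^bsub>H\<^esub> a k x = N #>\<^bsub>H\<^esub> a l x"
    using ev_const[OF assms] ..
  have "limit_coset N x = N #>\<^bsub>H\<^esub> a k x" if k: "k \<ge> K" and x: "x \<in> carrier G" for k x
    unfolding limit_coset_def
  proof (rule the_equality)
    show ev: "\<forall>\<^sub>F l in sequentially. N #>\<^bsub>H\<^esub> a l x = N #>\<^bsub>H\<^esub> a k x"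
      unfolding eventually_sequentially using K k x by blast
    fix C assume "\<forall>\<^sub>F l in sequentially. N #>\<^bsub>H\<^esub> a l x = C"
    with ev have "\<forall>\<^sub>F l in sequentially. C = N #>\<^bsub>H\<^esub> a k x"
      by eventually_elim simp
    then show "C = N #>\<^bsub>H\<^esub> a k x" by simp
  qed
  then show ?thesis by blast
qed

lemma limit_coset_hom:
  assumes N: "N \<in> finite_index_normal_subgroups H"
  shows "group_hom G (H Mod N) (limit_coset N)"
proof -
  interpret N: normal N H by (rule H.finite_index_normalD(1)[OF N])
  obtain K where K: "\<forall>k\<ge>K. \<forall>x \<in> carrier G. limit_coset N x = N #>\<^bsub>H\<^esub> a k x"
    using limit_coset_eventually[OF N] ..
  obtain L where L: "\<forall>k\<ge>L. \<forall>x \<in> carrier G. \<forall>y \<in> carrier G.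
      N #>\<^bsub>H\<^esub> a k (x \<otimes>\<^bsub>G\<^esub> y) = N #>\<^bsub>H\<^esub> (a k x \<otimes>\<^bsub>H\<^esub> a k y)"
    using ev_hom[OF N] ..
  have "limit_coset N \<in> hom G (H Mod N)"
  proof (rule homI)
    fix x y assume x: "x \<in> carrier G" and y: "y \<in> carrier G"
    show "limit_coset N x \<in> carrier (H Mod N)"
      using K[rule_format, of K x] x closed by (auto simp: carrier_FactGroup)
    show "limit_coset N (x \<otimes>\<^bsub>G\<^esub> y) = limit_coset N x \<otimes>\<^bsub>H Mod N\<^esub> limit_coset N y"
      using K[rule_format, of "max K L"] L[rule_format, of "max K L"] x y closed
      by (simp add: N.rcos_sum)
  qed
  then show ?thesis
    using G.is_group N.factorgroup_is_group by (simp add: group_hom_def group_hom_axioms_def)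
qed

lemma pullback_finite_index:
  assumes N: "N \<in> finite_index_normal_subgroups H"
  shows "pullback N \<in> finite_index_normal_subgroups G"
  unfolding pullback_def
  by (rule group_hom.kernel_finite_index[OF limit_coset_hom[OF N] H.finite_index_normalD(3)[OF N]])

lemma limit_coset_mono:
  assumes M: "M \<in> finite_index_normal_subgroups H" and N: "N \<in> finite_index_normal_subgroups H"
    and "M \<subseteq> N" and x: "x \<in> carrier G"
  shows "N <#>\<^bsub>H\<^esub> limit_coset M x = limit_coset N x"
proof -
  obtain K where K: "\<forall>k\<ge>K. \<forall>x \<in> carrier G. limit_coset N x = N #>\<^bsub>H\<^esub> a k x"
    using limit_coset_eventually[OF N] ..
  obtain L where L: "\<forall>k\<ge>L. \<forall>x \<in> carrier G. limit_coset M x = M #>\<^bsub>H\<^esub> a k x"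
    using limit_coset_eventually[OF M] ..
  have "limit_coset N x = N #>\<^bsub>H\<^esub> a (max K L) x" "limit_coset M x = M #>\<^bsub>H\<^esub> a (max K L) x"
    using K[rule_format, OF _ x] L[rule_format, OF _ x] by simp_all
  then show ?thesis
    using quotient_projection_coset[OF H.finite_index_normalD(1)[OF M] H.finite_index_normalD(1)[OF N]
        \<open>M \<subseteq> N\<close> closed[OF x, of "max K L"]]
    by (simp only: quotient_projection_def)
qed

lemma pullback_mono:
  assumes M: "M \<in> finite_index_normal_subgroups H" and N: "N \<in> finite_index_normal_subgroups H"
    and MN: "M \<subseteq> N"
  shows "pullback M \<subseteq> pullback N"
proof
  fix x assume "x \<in> pullback M"
  then have x: "x \<in> carrier G" "limit_coset M x = M"
    unfolding pullback_iff by (rule conjunct1, rule conjunct2)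
  interpret M: subgroup M H by (rule H.finite_index_normalD(2)[OF M])
  interpret N: subgroup N H by (rule H.finite_index_normalD(2)[OF N])
  have "limit_coset N x = N <#>\<^bsub>H\<^esub> (M #>\<^bsub>H\<^esub> \<one>\<^bsub>H\<^esub>)"
    using limit_coset_mono[OF M N MN x(1)] x(2) H.coset_mult_one[OF M.subset] by simp
  also have "\<dots> = N #>\<^bsub>H\<^esub> \<one>\<^bsub>H\<^esub>"
    using quotient_projection_coset[OF H.finite_index_normalD(1)[OF M] H.finite_index_normalD(1)[OF N] MN]
    by (simp add: quotient_projection_def)
  finally show "x \<in> pullback N"
    using x H.coset_mult_one[OF N.subset] by (simp add: pullback_def kernel_def)
qed

lemma limit_coset_eq_on_coset:
  assumes N: "N \<in> finite_index_normal_subgroups H"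
    and C: "C \<in> carrier (G Mod pullback N)" and "g \<in> C" "g' \<in> C"
  shows "limit_coset N g = limit_coset N g'"
  using group_hom.eq_on_kernel_coset[OF limit_coset_hom[OF N]] assms(2-4)
  unfolding pullback_def .

lemma completion_map_component:
  assumes N: "N \<in> finite_index_normal_subgroups H"
    and y: "y \<in> carrier (profinite_completion G)" and g: "g \<in> y (pullback N)"
  shows "completion_map y N = limit_coset N g"
proof -
  have C: "y (pullback N) \<in> carrier (G Mod pullback N)"
    using y pullback_finite_index[OF N] by (auto simp: G.mem_profinite_completion)
  have "(SOME g. g \<in> y (pullback N)) \<in> y (pullback N)"
    using g by (rule someI)
  then show ?thesis
    using limit_coset_eq_on_coset[OF N C _ g] N by (simp add: completion_map_def)
qed

lemma completion_map_closed:
  assumes y: "y \<in> carrier (profinite_completion G)"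
  shows "completion_map y \<in> carrier (profinite_completion H)"
  unfolding H.mem_profinite_completion
proof (intro conjI ballI impI PiE_I)
  fix N assume N: "N \<in> finite_index_normal_subgroups H"
  obtain g where "g \<in> carrier G" "g \<in> y (pullback N)"
    by (rule G.component_representative[OF pullback_finite_index[OF N] y])
  then show "completion_map y N \<in> carrier (H Mod N)"
    using group_hom.hom_closed[OF limit_coset_hom[OF N]] completion_map_component[OF N y] by metis
next
  fix M N assume M: "M \<in> finite_index_normal_subgroups H" and N: "N \<in> finite_index_normal_subgroups H"
    and MN: "M \<subseteq> N"
  obtain g where g: "g \<in> carrier G" "g \<in> y (pullback M)"
    by (rule G.component_representative[OF pullback_finite_index[OF M] y])
  have g': "g \<in> y (pullback N)"
    by (rule G.component_coset(2)[OF pullback_finite_index[OF M] pullback_finite_index[OF N]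
          pullback_mono[OF M N MN] y g(2)])
  show "N <#>\<^bsub>H\<^esub> completion_map y M = completion_map y N"
    unfolding completion_map_component[OF M y g(2)] completion_map_component[OF N y g']
    by (rule limit_coset_mono[OF M N MN g(1)])
qed (simp add: completion_map_def)

lemma completion_map_hom:
  "completion_map \<in> hom (profinite_completion G) (profinite_completion H)"
proof (rule homI)
  fix x y assume x: "x \<in> carrier (profinite_completion G)" and y: "y \<in> carrier (profinite_completion G)"
  show "completion_map x \<in> carrier (profinite_completion H)"
    by (rule completion_map_closed[OF x])
  have "completion_map (x \<otimes>\<^bsub>profinite_completion G\<^esub> y) N
      = completion_map x N <#>\<^bsub>H\<^esub> completion_map y N"
    if N: "N \<in> finite_index_normal_subgroups H" for N
  proof -
    interpret h: group_hom G "H Mod N" "limit_coset N" by (rule limit_coset_hom[OF N])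
    note P = pullback_finite_index[OF N]
    interpret P: normal "pullback N" G by (rule G.finite_index_normalD(1)[OF P])
    obtain g where g: "g \<in> carrier G" "g \<in> x (pullback N)"
      by (rule G.component_representative[OF P x])
    obtain g' where g': "g' \<in> carrier G" "g' \<in> y (pullback N)"
      by (rule G.component_representative[OF P y])
    have gg': "g \<otimes>\<^bsub>G\<^esub> g' \<in> x (pullback N) <#>\<^bsub>G\<^esub> y (pullback N)"
      unfolding set_mult_def using g(2) g'(2) by blast
    have "x (pullback N) \<in> carrier (G Mod pullback N)" "y (pullback N) \<in> carrier (G Mod pullback N)"
      using x y P by (auto simp: G.mem_profinite_completion)
    then have C: "x (pullback N) <#>\<^bsub>G\<^esub> y (pullback N) \<in> carrier (G Mod pullback N)"
      using monoid.m_closed[OF group.is_monoid[OF P.factorgroup_is_group]] by simp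
    have "(SOME u. u \<in> x (pullback N) <#>\<^bsub>G\<^esub> y (pullback N)) \<in> x (pullback N) <#>\<^bsub>G\<^esub> y (pullback N)"
      using gg' by (rule someI)
    then have "completion_map (x \<otimes>\<^bsub>profinite_completion G\<^esub> y) N = limit_coset N (g \<otimes>\<^bsub>G\<^esub> g')"
      using limit_coset_eq_on_coset[OF N C _ gg'] N P
      by (simp add: completion_map_def profinite_completion_def)
    also have "\<dots> = limit_coset N g <#>\<^bsub>H\<^esub> limit_coset N g'"
      using h.hom_mult[OF g(1) g'(1)] by simp
    finally show ?thesis
      unfolding completion_map_component[OF N x g(2)] completion_map_component[OF N y g'(2)] .
  qed
  moreover have "completion_map (x \<otimes>\<^bsub>profinite_completion G\<^esub> y) N = undefined"
    if "N \<notin> finite_index_normal_subgroups H" for N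
    using that by (simp add: completion_map_def)
  ultimately show "completion_map (x \<otimes>\<^bsub>profinite_completion G\<^esub> y)
      = completion_map x \<otimes>\<^bsub>profinite_completion H\<^esub> completion_map y"
    by (auto simp: profinite_completion_def fun_eq_iff)
qed

lemma completion_map_continuous:
  "continuous_map (profinite_topology G) (profinite_topology H) completion_map"
  unfolding profinite_topology_def[of H] continuous_map_in_subtopology
proof (intro conjI)
  show "completion_map \<in> topspace (profinite_topology G) \<rightarrow> carrier (profinite_completion H)"
    using completion_map_closed by auto
  show "continuous_map (profinite_topology G)
     (product_topology (\<lambda>N. discrete_topology (carrier (H Mod N))) (finite_index_normal_subgroups H))
     completion_map"
    unfolding continuous_map_componentwise
  proof (intro conjI ballI)
    show "completion_map ` topspace (profinite_topology G)
        \<subseteq> extensional (finite_index_normal_subgroups H)"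
      by (auto simp: completion_map_def)
    fix N assume N: "N \<in> finite_index_normal_subgroups H"
    interpret h: group_hom G "H Mod N" "limit_coset N" by (rule limit_coset_hom[OF N])
    note P = pullback_finite_index[OF N]
    interpret P: normal "pullback N" G by (rule G.finite_index_normalD(1)[OF P])
    have proj: "continuous_map (profinite_topology G) (discrete_topology (carrier (G Mod pullback N)))
        (\<lambda>y. y (pullback N))"
      unfolding profinite_topology_def
      by (rule continuous_map_from_subtopology, rule continuous_map_product_projection[OF P])
    have "limit_coset N (SOME g. g \<in> C) \<in> carrier (H Mod N)" if C: "C \<in> carrier (G Mod pullback N)" for C
      by (rule h.hom_closed[OF P.coset_eq_of_mem(1)[OF C someI_ex[OF P.coset_nonempty[OF C]]]])
    then have "continuous_map (discrete_topology (carrier (G Mod pullback N)))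
        (discrete_topology (carrier (H Mod N))) (\<lambda>C. limit_coset N (SOME g. g \<in> C))"
      by simp
    from continuous_map_compose[OF proj this]
    show "continuous_map (profinite_topology G) (discrete_topology (carrier (H Mod N)))
        (\<lambda>y. completion_map y N)"
      using N by (simp add: completion_map_def o_def)
  qed
qed

end

text \<open>The approximate maps \<open>b k\<close> and \<open>a k\<close> must be compared at a common stage \<open>k\<close> that is late enough
  both for \<open>M\<close> and for the pullback of \<open>M\<close> to the other group.\<close>

lemma completion_map_inverse:
  assumes "approximate_hom G H a" "approximate_hom H G b"
    and inv: "\<And>M. M \<in> finite_index_normal_subgroups G \<Longrightarrow>
      \<exists>K. \<forall>k\<ge>K. \<forall>x \<in> carrier G. M #>\<^bsub>G\<^esub> b k (a k x) = M #>\<^bsub>G\<^esub> x"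
    and y: "y \<in> carrier (profinite_completion G)"
  shows "approximate_hom.completion_map H G b (approximate_hom.completion_map G H a y) = y"
proof -
  interpret a: approximate_hom G H a by fact
  interpret b: approximate_hom H G b by fact
  note ay = a.completion_map_closed[OF y]
  have "b.completion_map (a.completion_map y) M = y M"
    if M: "M \<in> finite_index_normal_subgroups G" for M
  proof -
    note Q = b.pullback_finite_index[OF M]
    note P = a.pullback_finite_index[OF Q]
    interpret M: normal M G by (rule a.G.finite_index_normalD(1)[OF M])
    interpret Q: normal "b.pullback M" H by (rule a.H.finite_index_normalD(1)[OF Q])
    obtain K1 where K1: "\<forall>k\<ge>K1. \<forall>x \<in> carrier G. M #>\<^bsub>G\<^esub> b k (a k x) = M #>\<^bsub>G\<^esub> x"
      using inv[OF M] ..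
    obtain K2 where K2: "\<forall>k\<ge>K2. \<forall>x \<in> carrier H. b.limit_coset M x = M #>\<^bsub>G\<^esub> b k x"
      using b.limit_coset_eventually[OF M] ..
    obtain K3 where K3: "\<forall>k\<ge>K3. \<forall>x \<in> carrier G. a.limit_coset (b.pullback M) x = b.pullback M #>\<^bsub>H\<^esub> a k x"
      using a.limit_coset_eventually[OF Q] ..
    define k where "k = max K1 (max K2 K3)"
    have k: "k \<ge> K1" "k \<ge> K2" "k \<ge> K3" by (auto simp: k_def)
    have key: "b.limit_coset M h = M #>\<^bsub>G\<^esub> x"
      if x: "x \<in> carrier G" and h: "h \<in> a.limit_coset (b.pullback M) x" for x h
    proof -
      have ax: "a k x \<in> carrier H" using a.closed x .
      have C: "b.pullback M #>\<^bsub>H\<^esub> a k x \<in> carrier (H Mod b.pullback M)"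
        using ax by (auto simp: carrier_FactGroup)
      have "h \<in> b.pullback M #>\<^bsub>H\<^esub> a k x"
        using h unfolding K3[rule_format, OF k(3) x] .
      then have "b.limit_coset M h = b.limit_coset M (a k x)"
        by (rule b.limit_coset_eq_on_coset[OF M C _ a.H.rcos_self[OF ax Q.subgroup_axioms]])
      then show ?thesis
        unfolding K2[rule_format, OF k(2) ax] K1[rule_format, OF k(1) x] .
    qed
    have PM: "a.pullback (b.pullback M) \<subseteq> M"
    proof
      fix x assume "x \<in> a.pullback (b.pullback M)"
      then have x: "x \<in> carrier G" "a.limit_coset (b.pullback M) x = b.pullback M"
        unfolding a.pullback_iff by (rule conjunct1, rule conjunct2)
      have "b.limit_coset M \<one>\<^bsub>H\<^esub> = M #>\<^bsub>G\<^esub> x"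
        using key[OF x(1), of "\<one>\<^bsub>H\<^esub>"] Q.one_closed unfolding x(2) .
      moreover have "b.limit_coset M \<one>\<^bsub>H\<^esub> = M"
        using Q.one_closed unfolding b.pullback_iff by (rule conjunct2)
      ultimately show "x \<in> M"
        using a.G.rcos_self[OF x(1) M.subgroup_axioms] by (simp only:)
    qed
    obtain g where g: "g \<in> carrier G" "g \<in> y (a.pullback (b.pullback M))"
      by (rule a.G.component_representative[OF P y])
    have yM: "y M = M #>\<^bsub>G\<^esub> g"
      by (rule a.G.component_coset(1)[OF P M PM y g(2)])
    have aQ: "a.completion_map y (b.pullback M) = a.limit_coset (b.pullback M) g"
      by (rule a.completion_map_component[OF Q y g(2)])
    obtain h where h: "h \<in> a.completion_map y (b.pullback M)"
      using a.H.component_representative[OF Q ay] .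
    have "b.completion_map (a.completion_map y) M = b.limit_coset M h"
      by (rule b.completion_map_component[OF M ay h])
    also have "\<dots> = y M"
      using key[OF g(1)] h unfolding aQ yM .
    finally show ?thesis .
  qed
  moreover have "b.completion_map (a.completion_map y) M = y M"
    if "M \<notin> finite_index_normal_subgroups G" for M
    using that y by (auto simp: b.completion_map_def a.G.mem_profinite_completion PiE_def extensional_def)
  ultimately show ?thesis by blast
qed

theorem isomorphic_completions_of_approximate_inverses:
  assumes a: "approximate_hom G H a" and b: "approximate_hom H G b"
    and ba: "\<And>M. M \<in> finite_index_normal_subgroups G \<Longrightarrow>
      \<exists>K. \<forall>k\<ge>K. \<forall>x \<in> carrier G. M #>\<^bsub>G\<^esub> b k (a k x) = M #>\<^bsub>G\<^esub> x"
    and ab: "\<And>N. N \<in> finite_index_normal_subgroups H \<Longrightarrow>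
      \<exists>K. \<forall>k\<ge>K. \<forall>y \<in> carrier H. N #>\<^bsub>H\<^esub> a k (b k y) = N #>\<^bsub>H\<^esub> y"
  shows "isomorphic_profinite_completions G H"
proof -
  interpret a: approximate_hom G H a by fact
  interpret b: approximate_hom H G b by fact
  note 1 = completion_map_inverse[OF a b ba] and 2 = completion_map_inverse[OF b a ab]
  have "bij_betw a.completion_map (carrier (profinite_completion G)) (carrier (profinite_completion H))"
    by (rule bij_betwI[where g = b.completion_map])
      (auto simp: 1 2 a.completion_map_closed b.completion_map_closed)
  then have "a.completion_map \<in> iso (profinite_completion G) (profinite_completion H)"
    using a.completion_map_hom by (simp add: iso_def)
  moreover have "homeomorphic_maps (profinite_topology G) (profinite_topology H)
      a.completion_map b.completion_map"
    by (simp add: homeomorphic_maps_def a.completion_map_continuous b.completion_map_continuous 1 2)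
  ultimately show ?thesis
    unfolding isomorphic_profinite_completions_def using homeomorphic_maps_imp_map by blast
qed

section \<open>Completions of two quotients of one group\<close>

lemma (in group) rcos_eq_iff:
  assumes "subgroup N G" "x \<in> carrier G" "y \<in> carrier G"
  shows "N #> x = N #> y \<longleftrightarrow> x \<otimes> inv y \<in> N"
proof
  assume "N #> x = N #> y"
  then have "x \<in> N #> y"
    using rcos_self[OF assms(2,1)] by (simp only:)
  then show "x \<otimes> inv y \<in> N"
    by (rule subgroup.rcos_module_imp[OF assms(1) is_group assms(3)])
next
  assume "x \<otimes> inv y \<in> N"
  then have "x \<in> N #> y"
    by (rule subgroup.rcos_module_rev[OF assms(1) is_group assms(3,2)])
  then show "N #> x = N #> y"
    using repr_independence[OF _ assms(3,1)] by metis
qed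

text \<open>Finite index subgroups of a quotient are handled through their preimages, so that all
  estimates take place in the one group \<open>E\<close>.\<close>

definition preimage_subgroup :: "('e, 'k) monoid_scheme \<Rightarrow> ('e \<Rightarrow> 'a) \<Rightarrow> 'a set \<Rightarrow> 'e set" where
  "preimage_subgroup E p N = {x \<in> carrier E. p x \<in> N}"

context group_hom
begin

lemma preimage_finite_index:
  assumes N: "N \<in> finite_index_normal_subgroups H"
  shows "preimage_subgroup G h N \<in> finite_index_normal_subgroups G"
proof -
  interpret N: normal N H by (rule H.finite_index_normalD(1)[OF N])
  have "(\<lambda>x. N #>\<^bsub>H\<^esub> h x) \<in> hom G (H Mod N)"
    by (rule homI) (auto simp: carrier_FactGroup N.rcos_sum)
  then interpret c: group_hom G "H Mod N" "\<lambda>x. N #>\<^bsub>H\<^esub> h x"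
    using N.factorgroup_is_group by (simp add: group_hom_def group_hom_axioms_def)
  have "N #>\<^bsub>H\<^esub> h x = N \<longleftrightarrow> h x \<in> N" if "x \<in> carrier G" for x
    using H.rcos_eq_iff[OF N.subgroup_axioms hom_closed[OF that] H.one_closed] that
    by (simp add: H.coset_mult_one N.subset)
  then have "kernel G (H Mod N) (\<lambda>x. N #>\<^bsub>H\<^esub> h x) = preimage_subgroup G h N"
    by (auto simp: kernel_def preimage_subgroup_def)
  then show ?thesis
    using c.kernel_finite_index[OF H.finite_index_normalD(3)[OF N]] by simp
qed

lemma coset_preimage:
  assumes N: "N \<in> finite_index_normal_subgroups H" and x: "x \<in> carrier G" and y: "y \<in> carrier G"
    and "preimage_subgroup G h N #> x = preimage_subgroup G h N #> y"
  shows "N #>\<^bsub>H\<^esub> h x = N #>\<^bsub>H\<^esub> h y"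
proof -
  have "x \<otimes> inv y \<in> preimage_subgroup G h N"
    using G.rcos_eq_iff[OF G.finite_index_normalD(2)[OF preimage_finite_index[OF N]] x y] assms(4)
    by simp
  then have "h x \<otimes>\<^bsub>H\<^esub> inv\<^bsub>H\<^esub> h y \<in> N"
    using x y by (simp add: preimage_subgroup_def)
  then show ?thesis
    using H.rcos_eq_iff[OF H.finite_index_normalD(2)[OF N] hom_closed[OF x] hom_closed[OF y]] by simp
qed

end

text \<open>Both quotients \<open>G\<close> and \<open>H\<close> of \<open>E\<close> are compared through endomorphisms of \<open>E\<close>. These need
  not send the kernel of \<open>p\<close> into the kernel of \<open>q\<close>; they only have to do so up to any given
  finite index subgroup, eventually. Lifting along an arbitrary section of \<open>p\<close> is harmless for
  the same reason.\<close>

locale approximate_quotient_map = p: group_hom E G p + q: group_hom E H q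
  for E :: "('e, 'k) monoid_scheme" and G :: "('a, 'm) monoid_scheme"
    and H :: "('b, 'n) monoid_scheme" and p q +
  fixes \<alpha> :: "nat \<Rightarrow> 'e \<Rightarrow> 'e"
  assumes surj: "p ` carrier E = carrier G"
    and endo: "\<alpha> k \<in> hom E E"
    and ev_const: "N \<in> finite_index_normal_subgroups E \<Longrightarrow>
      \<exists>K. \<forall>k\<ge>K. \<forall>l\<ge>K. \<forall>x \<in> carrier E. N #>\<^bsub>E\<^esub> \<alpha> k x = N #>\<^bsub>E\<^esub> \<alpha> l x"
    and ev_kernel: "N \<in> finite_index_normal_subgroups E \<Longrightarrow> kernel E H q \<subseteq> N \<Longrightarrow>
      \<exists>K. \<forall>k\<ge>K. \<alpha> k ` kernel E G p \<subseteq> N"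
begin

definition lift :: "'a \<Rightarrow> 'e" where "lift = inv_into (carrier E) p"

definition approx :: "nat \<Rightarrow> 'a \<Rightarrow> 'b" where "approx k g = q (\<alpha> k (lift g))"

lemma lift_closed: "g \<in> carrier G \<Longrightarrow> lift g \<in> carrier E"
  unfolding lift_def surj[symmetric] by (rule inv_into_into)

lemma p_lift: "g \<in> carrier G \<Longrightarrow> p (lift g) = g"
  unfolding lift_def surj[symmetric] by (rule f_inv_into_f)

lemma endo_closed: "x \<in> carrier E \<Longrightarrow> \<alpha> k x \<in> carrier E"
  using endo[of k] by (auto simp: hom_def)

lemma endo_hom: "group_hom E E (\<alpha> k)"
  using endo[of k] p.G.is_group by (simp add: group_hom_def group_hom_axioms_def)

lemma approx_closed: "g \<in> carrier G \<Longrightarrow> approx k g \<in> carrier H"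
  by (simp add: approx_def lift_closed endo_closed)

text \<open>Late approximations do not depend on the lift: two lifts differ by an element of the kernel
  of \<open>p\<close>, which \<open>\<alpha> k\<close> eventually moves into the preimage of \<open>N\<close>.\<close>

lemma approx_eventually:
  assumes N: "N \<in> finite_index_normal_subgroups H"
  shows "\<exists>K. \<forall>k\<ge>K. \<forall>x \<in> carrier E. N #>\<^bsub>H\<^esub> approx k (p x) = N #>\<^bsub>H\<^esub> q (\<alpha> k x)"
proof -
  interpret N: normal N H by (rule q.H.finite_index_normalD(1)[OF N])
  have "kernel E H q \<subseteq> preimage_subgroup E q N"
    by (auto simp: kernel_def preimage_subgroup_def)
  then obtain K where K: "\<forall>k\<ge>K. \<alpha> k ` kernel E G p \<subseteq> preimage_subgroup E q N"
    using ev_kernel[OF q.preimage_finite_index[OF N]] by metis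
  have "N #>\<^bsub>H\<^esub> approx k (p x) = N #>\<^bsub>H\<^esub> q (\<alpha> k x)" if k: "k \<ge> K" and x: "x \<in> carrier E" for k x
  proof -
    interpret endo: group_hom E E "\<alpha> k" by (rule endo_hom)
    define d where "d = lift (p x) \<otimes>\<^bsub>E\<^esub> inv\<^bsub>E\<^esub> x"
    have l: "lift (p x) \<in> carrier E" using x by (simp add: lift_closed)
    have "d \<in> kernel E G p"
      using x l p_lift[of "p x"] by (simp add: d_def kernel_def)
    then have "\<alpha> k d \<in> preimage_subgroup E q N"
      using K k by blast
    moreover have "q (\<alpha> k d) = approx k (p x) \<otimes>\<^bsub>H\<^esub> inv\<^bsub>H\<^esub> q (\<alpha> k x)"
      using x l by (simp add: d_def approx_def)
    ultimately have "approx k (p x) \<otimes>\<^bsub>H\<^esub> inv\<^bsub>H\<^esub> q (\<alpha> k x) \<in> N"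
      by (simp add: preimage_subgroup_def)
    then show ?thesis
      using q.H.rcos_eq_iff[OF N.subgroup_axioms] approx_closed x by (simp add: endo_closed)
  qed
  then show ?thesis by metis
qed

lemma approx_hom: "approximate_hom G H approx"
proof (unfold_locales, goal_cases)
  case (1 x k)
  then show ?case by (rule approx_closed)
next
  case (2 N)
  interpret N: normal N H by (rule q.H.finite_index_normalD(1)[OF 2])
  obtain K where K: "\<forall>k\<ge>K. \<forall>x \<in> carrier E. N #>\<^bsub>H\<^esub> approx k (p x) = N #>\<^bsub>H\<^esub> q (\<alpha> k x)"
    using approx_eventually[OF 2] ..
  have "N #>\<^bsub>H\<^esub> approx k (x \<otimes>\<^bsub>G\<^esub> y) = N #>\<^bsub>H\<^esub> (approx k x \<otimes>\<^bsub>H\<^esub> approx k y)"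
    if k: "k \<ge> K" and x: "x \<in> carrier G" and y: "y \<in> carrier G" for k x y
  proof -
    interpret endo: group_hom E E "\<alpha> k" by (rule endo_hom)
    have "lift x \<otimes>\<^bsub>E\<^esub> lift y \<in> carrier E"
      using x y by (simp add: lift_closed)
    note K[rule_format, OF k this]
    then show ?thesis
      using x y by (simp add: lift_closed p_lift approx_def)
  qed
  then show ?case by metis
next
  case (3 N)
  obtain K where K: "\<forall>k\<ge>K. \<forall>l\<ge>K. \<forall>x \<in> carrier E.
      preimage_subgroup E q N #>\<^bsub>E\<^esub> \<alpha> k x = preimage_subgroup E q N #>\<^bsub>E\<^esub> \<alpha> l x"
    using ev_const[OF q.preimage_finite_index[OF 3]] ..
  have "N #>\<^bsub>H\<^esub> approx k x = N #>\<^bsub>H\<^esub> approx l x" if "k \<ge> K" "l \<ge> K" "x \<in> carrier G" for k l x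
    unfolding approx_def
    by (rule q.coset_preimage[OF 3 endo_closed endo_closed K[rule_format]])
      (simp_all add: that lift_closed)
  then show ?case by metis
qed

end

lemma approx_inverse:
  assumes a: "approximate_quotient_map E G H p q \<alpha>" and b: "approximate_quotient_map E H G q p \<beta>"
    and ba: "\<And>k x. x \<in> carrier E \<Longrightarrow> \<beta> k (\<alpha> k x) = x"
    and M: "M \<in> finite_index_normal_subgroups G"
  shows "\<exists>K. \<forall>k\<ge>K. \<forall>x \<in> carrier G.
    M #>\<^bsub>G\<^esub> approximate_quotient_map.approx E q p \<beta> k
        (approximate_quotient_map.approx E p q \<alpha> k x) = M #>\<^bsub>G\<^esub> x"
proof -
  interpret a: approximate_quotient_map E G H p q \<alpha> by fact
  interpret b: approximate_quotient_map E H G q p \<beta> by fact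
  obtain K where K: "\<forall>k\<ge>K. \<forall>x \<in> carrier E. M #>\<^bsub>G\<^esub> b.approx k (q x) = M #>\<^bsub>G\<^esub> p (\<beta> k x)"
    using b.approx_eventually[OF M] ..
  have "M #>\<^bsub>G\<^esub> b.approx k (a.approx k x) = M #>\<^bsub>G\<^esub> x" if k: "k \<ge> K" and x: "x \<in> carrier G" for k x
  proof -
    note l = a.lift_closed[OF x]
    show ?thesis
      using K[rule_format, OF k a.endo_closed[OF l, of k]]
      unfolding a.approx_def[of k x] ba[OF l] a.p_lift[OF x] .
  qed
  then show ?thesis by metis
qed

theorem isomorphic_completions_of_quotients:
  assumes a: "approximate_quotient_map E G H p q \<alpha>" and b: "approximate_quotient_map E H G q p \<beta>"
    and ba: "\<And>k x. x \<in> carrier E \<Longrightarrow> \<beta> k (\<alpha> k x) = x"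
    and ab: "\<And>k x. x \<in> carrier E \<Longrightarrow> \<alpha> k (\<beta> k x) = x"
  shows "isomorphic_profinite_completions G H"
  by (rule isomorphic_completions_of_approximate_inverses
      [OF approximate_quotient_map.approx_hom[OF a] approximate_quotient_map.approx_hom[OF b]
        approx_inverse[OF a b ba] approx_inverse[OF b a ab]])

text \<open>The carrier of a quotient is transported to \<^typ>\<open>nat\<close> along an enumeration of the cosets.\<close>

lemma quotient_on_nat:
  assumes "group E" "D \<lhd> E" "countable (carrier E)"
  obtains G :: "nat monoid" and p where "group_hom E G p" "p ` carrier E = carrier G" "kernel E G p = D"
proof -
  interpret D: normal D E by fact
  interpret Q: group "E Mod D" by (rule D.factorgroup_is_group)
  define C where "C = carrier (E Mod D)"
  define f where "f = to_nat_on C"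
  have "countable C"
    using assms(3) by (simp add: C_def carrier_FactGroup)
  then have inj: "inj_on f C"
    unfolding f_def by (rule inj_on_to_nat_on)
  define U :: "nat monoid" where
    "U = \<lparr>carrier = UNIV, monoid.mult = (\<lambda>m n. f (inv_into C f m \<otimes>\<^bsub>E Mod D\<^esub> inv_into C f n)), one = f \<one>\<^bsub>E Mod D\<^esub>\<rparr>"
  define G where "G = U\<lparr>carrier := f ` carrier (E Mod D), one := f \<one>\<^bsub>E Mod D\<^esub>\<rparr>"
  have homU: "f \<in> hom (E Mod D) U"
    by (rule homI) (simp_all add: U_def inv_into_f_f[OF inj] flip: C_def)
  have G: "group G"
    unfolding G_def by (rule Q.hom_imp_img_group[OF homU])
  have f: "f \<in> hom (E Mod D) G"
    using homU by (auto simp: hom_def G_def)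
  have "(\<lambda>x. f (D #>\<^bsub>E\<^esub> x)) \<in> hom E G"
    using hom_compose[OF D.r_coset_hom_Mod f] by (simp add: o_def)
  then have "group_hom E G (\<lambda>x. f (D #>\<^bsub>E\<^esub> x))"
    using G assms(1) by (simp add: group_hom_def group_hom_axioms_def)
  moreover have "(\<lambda>x. f (D #>\<^bsub>E\<^esub> x)) ` carrier E = carrier G"
    by (simp add: G_def carrier_FactGroup image_image)
  moreover have "kernel E G (\<lambda>x. f (D #>\<^bsub>E\<^esub> x)) = D"
  proof -
    have "f (D #>\<^bsub>E\<^esub> x) = f D \<longleftrightarrow> x \<in> D" if x: "x \<in> carrier E" for x
    proof -
      have "D #>\<^bsub>E\<^esub> x \<in> C" using x by (auto simp: C_def carrier_FactGroup)
      moreover have "D \<in> C" using Q.one_closed by (simp add: C_def)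
      ultimately have "f (D #>\<^bsub>E\<^esub> x) = f D \<longleftrightarrow> D #>\<^bsub>E\<^esub> x = D"
        using inj_on_eq_iff[OF inj] by simp
      then show ?thesis
        using D.rcos_eq_iff[OF D.subgroup_axioms x D.one_closed] x
        by (simp add: D.coset_mult_one D.subset)
    qed
    then show ?thesis
      using D.subset by (auto simp: kernel_def G_def)
  qed
  ultimately show thesis by (rule that)
qed

lemma (in group_hom) finitely_generated_image:
  assumes "finite S" "S \<subseteq> carrier G" "generate G S = carrier G" "h ` carrier G = carrier H"
  shows "finitely_generated_group H"
proof -
  have "generate H (h ` S) = carrier H"
    using generate_img[OF assms(2)] assms(3,4) by simp
  then show ?thesis
    using assms H.is_group unfolding finitely_generated_group_def by (metis finite_imageI image_mono)
qed

section \<open>The matrix group over the Laurent polynomials\<close>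

type_synonym laurent = "int \<Rightarrow>\<^sub>0 int"

abbreviation T :: "int \<Rightarrow> laurent" where "T n \<equiv> Poly_Mapping.single n 1"

lemma T_mult: "T m * T n = T (m + n)"
  by (simp add: mult_single)

lemma T_mult_left: "T m * (T n * c) = T (m + n) * c"
  by (simp add: T_mult flip: mult.assoc)

text \<open>A nonempty set closed under differences is an additive subgroup. The description by
  differences matches the induction principle for integer combinations of the \<open>t\<^sup>m\<close>.\<close>

locale diff_closed =
  fixes A :: "'a::comm_ring_1 set"
  assumes zero: "0 \<in> A" and diff: "x \<in> A \<Longrightarrow> y \<in> A \<Longrightarrow> x - y \<in> A"
begin

lemma neg: "x \<in> A \<Longrightarrow> - x \<in> A"
  using diff[OF zero] by simp

lemma add: "x \<in> A \<Longrightarrow> y \<in> A \<Longrightarrow> x + y \<in> A"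
  using diff[OF _ neg] by fastforce

lemma of_nat_times: "x \<in> A \<Longrightarrow> of_nat n * x \<in> A"
  by (induction n) (simp_all add: zero add distrib_right)

lemma of_int_times: "x \<in> A \<Longrightarrow> of_int z * x \<in> A"
  by (cases z) (use of_nat_times neg in \<open>auto simp del: of_nat_Suc\<close>)

end

lemma all_laurent:
  assumes "diff_closed B" "\<And>m. T m \<in> B"
  shows "c \<in> B"
  using frag_induction[of c UNIV "\<lambda>c. c \<in> B"] diff_closed.zero diff_closed.diff assms by blast

type_synonym mat = "laurent \<times> int \<times> laurent \<times> laurent"

text \<open>The quadruple \<open>(a, n, b, c)\<close> stands for the upper triangular matrix with rows
  \<open>(1, a, c)\<close>, \<open>(0, t\<^sup>n, b)\<close> and \<open>(0, 0, 1)\<close>.\<close>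

definition mat_group :: "mat monoid" where
  "mat_group = \<lparr>carrier = UNIV,
     monoid.mult = (\<lambda>(a, n, b, c) (a', n', b', c'). (a' + a * T n', n + n', b + T n * b', c + a * b' + c')),
     one = (0, 0, 0, 0)\<rparr>"

lemma carrier_mat_group [simp]: "carrier mat_group = UNIV"
  by (simp add: mat_group_def)

lemma one_mat_group [simp]: "\<one>\<^bsub>mat_group\<^esub> = (0, 0, 0, 0)"
  by (simp add: mat_group_def)

lemma mult_mat_group [simp]:
  "(a, n, b, c) \<otimes>\<^bsub>mat_group\<^esub> (a', n', b', c') = (a' + a * T n', n + n', b + T n * b', c + a * b' + c')"
  by (simp add: mat_group_def)

lemma mat_group_inverse:
  "(- (a * T (- n)), - n, - (T (- n) * b), a * T (- n) * b - c) \<otimes>\<^bsub>mat_group\<^esub> (a, n, b, c) = (0, 0, 0, 0)"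
  by (simp add: T_mult mult.assoc)

lemma group_mat_group: "group mat_group"
proof (rule groupI)
  fix x y z :: mat
  show "x \<otimes>\<^bsub>mat_group\<^esub> y \<otimes>\<^bsub>mat_group\<^esub> z = x \<otimes>\<^bsub>mat_group\<^esub> (y \<otimes>\<^bsub>mat_group\<^esub> z)"
    by (cases x, cases y, cases z) (simp add: algebra_simps T_mult T_mult_left)
  show "\<one>\<^bsub>mat_group\<^esub> \<otimes>\<^bsub>mat_group\<^esub> x = x"
    by (cases x) simp
  show "\<exists>y\<in>carrier mat_group. y \<otimes>\<^bsub>mat_group\<^esub> x = \<one>\<^bsub>mat_group\<^esub>"
    using mat_group_inverse by (cases x) (metis UNIV_I carrier_mat_group one_mat_group)
qed simp_all

interpretation M: group mat_group by (rule group_mat_group)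

lemma inv_mat_group [simp]:
  "inv\<^bsub>mat_group\<^esub> (a, n, b, c) = (- (a * T (- n)), - n, - (T (- n) * b), a * T (- n) * b - c)"
  by (rule M.inv_equality) (simp_all add: mat_group_inverse del: mult_mat_group)

lemma countable_laurent: "countable (UNIV :: laurent set)"
proof -
  define code :: "laurent \<Rightarrow> (int \<times> int) list" where
    "code c = map (\<lambda>m. (m, Poly_Mapping.lookup c m)) (sorted_list_of_set (Poly_Mapping.keys c))" for c
  have "inj code"
  proof (rule injI)
    fix c d assume "code c = code d"
    then have s: "set (code c) = set (code d)" by simp
    have mem: "(m, v) \<in> set (code c) \<longleftrightarrow> v = Poly_Mapping.lookup c m \<and> v \<noteq> 0" for c m v
      by (auto simp: code_def in_keys_iff)
    show "c = d"
      by (rule poly_mapping_eqI) (metis s mem)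
  qed
  then show ?thesis
    using countable_image_inj_on[of code UNIV] by simp
qed

text \<open>Conjugation by the diagonal matrix with entries \<open>1, 1, t\<^sup>-\<^sup>s\<close>; for \<open>s \<noteq> 0\<close> it is not
  an inner automorphism, since it moves the central matrices.\<close>

definition shift :: "int \<Rightarrow> mat \<Rightarrow> mat" where
  "shift s = (\<lambda>(a, n, b, c). (a, n, T s * b, T s * c))"

lemma shift_simp [simp]: "shift s (a, n, b, c) = (a, n, T s * b, T s * c)"
  by (simp add: shift_def)

lemma shift_hom: "shift s \<in> hom mat_group mat_group"
proof (rule homI)
  fix x y :: mat
  show "shift s (x \<otimes>\<^bsub>mat_group\<^esub> y) = shift s x \<otimes>\<^bsub>mat_group\<^esub> shift s y"
    by (cases x, cases y) (simp add: algebra_simps T_mult T_mult_left)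
qed simp

lemma shift_shift: "shift s (shift s' x) = shift (s + s') x"
  by (cases x) (simp add: T_mult_left)

lemma shift_0 [simp]: "shift 0 x = x"
  by (cases x) simp

text \<open>Conjugating the elementary matrices by powers of \<open>t\<close> yields all \<open>t\<^sup>m\<close> as entries \<open>a\<close> and \<open>b\<close>,
  and the commutator of the matrices with entries \<open>a = 1\<close> and \<open>b = c\<close> is the central matrix \<open>c\<close>.\<close>

lemma generate_mat_group:
  "generate mat_group {(1, 0, 0, 0), (0, 1, 0, 0), (0, 0, 1, 0)} = carrier mat_group"
    (is "?H = _")
proof -
  have sub: "subgroup ?H mat_group"
    by (rule M.generate_is_subgroup) simp
  note m = subgroup.m_closed[OF sub] and i = subgroup.m_inv_closed[OF sub]
  have gens: "(1, 0, 0, 0) \<in> ?H" "(0, 1, 0, 0) \<in> ?H" "(0, 0, 1, 0) \<in> ?H"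
    by (auto intro: generate.incl)
  have tn: "(0, int n, 0, 0) \<in> ?H" for n
  proof (induction n)
    case 0
    then show ?case using subgroup.one_closed[OF sub] by simp
  next
    case (Suc n)
    then show ?case using m[OF gens(2) Suc] by simp
  qed
  have t: "(0, n, 0, 0) \<in> ?H" for n
    using tn[of "nat n"] i[OF tn[of "nat (- n)"]] by (cases "n \<ge> 0") simp_all
  interpret X: diff_closed "{a. (a, 0, 0, 0) \<in> ?H}"
    by unfold_locales (use subgroup.one_closed[OF sub] m[OF _ i] in \<open>force+\<close>)
  have x: "(a, 0, 0, 0) \<in> ?H" for a
  proof -
    have "(T n, 0, 0, 0) \<in> ?H" for n
      using m[OF m[OF t[of "- n"] gens(1)] t[of n]] by simp
    then show ?thesis using all_laurent[OF X.diff_closed_axioms] by simp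
  qed
  interpret Y: diff_closed "{b. (0, 0, b, 0) \<in> ?H}"
    by unfold_locales (use subgroup.one_closed[OF sub] m[OF _ i] in \<open>force+\<close>)
  have y: "(0, 0, b, 0) \<in> ?H" for b
  proof -
    have "(0, 0, T n, 0) \<in> ?H" for n
      using m[OF m[OF t[of n] gens(3)] t[of "- n"]] by simp
    then show ?thesis using all_laurent[OF Y.diff_closed_axioms] by simp
  qed
  have z: "(0, 0, 0, c) \<in> ?H" for c
    using m[OF m[OF x[of 1] y[of c]] m[OF i[OF x[of 1]] i[OF y[of c]]]] by simp
  have "(a, n, b, c) \<in> ?H" for a n b c
    using m[OF m[OF z[of c] y[of b]] m[OF t[of n] x[of a]]] by simp
  then show ?thesis by auto
qed

text \<open>A finite index normal subgroup contains a power \<open>t\<^sup>e\<close>, and then, being normal, it contains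
  all \<open>(t\<^sup>e - 1) b\<close> in the positions \<open>b\<close> and \<open>c\<close>: only exponents modulo \<open>e\<close> matter there.\<close>

lemma finite_index_period:
  assumes N: "N \<in> finite_index_normal_subgroups mat_group"
  obtains e :: nat where "e > 0"
    "\<And>n b. int e dvd n \<Longrightarrow> (0, 0, T n * b - b, 0) \<in> N"
    "\<And>n b. int e dvd n \<Longrightarrow> (0, 0, 0, T n * b - b) \<in> N"
proof -
  interpret N: normal N mat_group by (rule M.finite_index_normalD(1)[OF N])
  interpret Q: group "mat_group Mod N" by (rule N.factorgroup_is_group)
  define e where "e = order (mat_group Mod N)"
  have "e > 0"
    using M.finite_index_normalD(3)[OF N] Q.order_gt_0_iff_finite by (simp add: e_def)
  \<comment> \<open>the order of the quotient is a period for \<open>t\<close>\<close>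
  have pow: "(0, 1, 0, 0) [^]\<^bsub>mat_group\<^esub> k = (0, int k, 0, 0)" for k :: nat
    by (induction k) (simp_all add: M.nat_pow_Suc)
  have "N #>\<^bsub>mat_group\<^esub> ((0, 1, 0, 0) [^]\<^bsub>mat_group\<^esub> e) = N"
    using N.FactGroup_pow[of "(0, 1, 0, 0)" e]
      Q.pow_order_eq_1[of "N #>\<^bsub>mat_group\<^esub> (0, 1, 0, 0)"] by (simp add: e_def carrier_FactGroup)
  then have "N #>\<^bsub>mat_group\<^esub> (0, int e, 0, 0) = N" by (simp only: pow)
  then have te: "(0, int e, 0, 0) \<in> N"
    using M.rcos_self[OF _ N.subgroup_axioms, of "(0, int e, 0, 0)"] by simp
  have ten: "(0, int e * int k, 0, 0) \<in> N" for k
  proof (induction k)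
    case 0
    then show ?case using N.one_closed by simp
  next
    case (Suc k)
    then show ?case using N.m_closed[OF te Suc] by (simp add: algebra_simps)
  qed
  have t: "(0, n, 0, 0) \<in> N" if "int e dvd n" for n
  proof -
    obtain k where "n = int e * k" using \<open>int e dvd n\<close> by blast
    then show ?thesis
      using ten[of "nat k"] N.m_inv_closed[OF ten[of "nat (- k)"]] by (cases "k \<ge> 0") simp_all
  qed
  \<comment> \<open>commutators of elements of \<open>N\<close> with \<open>b\<close>-matrices, and then with the matrix \<open>a = 1\<close>\<close>
  have y: "(0, 0, T n * b - b, 0) \<in> N" if "int e dvd n" for n b
    using N.m_closed[OF t[OF that] N.inv_op_closed2[OF _ N.m_inv_closed[OF t[OF that]], of "(0, 0, b, 0)"]]
    by (simp add: T_mult_left right_diff_distrib)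
  moreover have "(0, 0, 0, T n * b - b) \<in> N" if "int e dvd n" for n b
    using N.m_closed[OF N.inv_op_closed2[OF _ y[OF that, of b], of "(1, 0, 0, 0)"] N.m_inv_closed[OF y[OF that, of b]]]
    by simp
  ultimately show thesis by (rule that[OF \<open>e > 0\<close>])
qed

lemma shift_cong_mod:
  assumes N: "N \<in> finite_index_normal_subgroups mat_group"
  obtains e :: nat where "e > 0"
    "\<And>s s' x. int e dvd s - s' \<Longrightarrow> N #>\<^bsub>mat_group\<^esub> shift s x = N #>\<^bsub>mat_group\<^esub> shift s' x"
proof -
  have sub: "subgroup N mat_group" by (rule M.finite_index_normalD(2)[OF N])
  obtain e :: nat where e: "e > 0"
    "\<And>n b. int e dvd n \<Longrightarrow> (0, 0, T n * b - b, 0) \<in> N"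
    "\<And>n b. int e dvd n \<Longrightarrow> (0, 0, 0, T n * b - b) \<in> N"
    by (rule finite_index_period[OF N]) (rule that)
  have "N #>\<^bsub>mat_group\<^esub> shift s x = N #>\<^bsub>mat_group\<^esub> shift s' x" if d: "int e dvd s - s'" for s s' x
  proof (cases x)
    case (fields a n b c)
    have "shift s x \<otimes>\<^bsub>mat_group\<^esub> inv\<^bsub>mat_group\<^esub> shift s' x
        = (0, 0, T (s - s') * (T s' * b) - T s' * b, 0)
          \<otimes>\<^bsub>mat_group\<^esub> (0, 0, 0, T (s - s') * (T s' * c) - T s' * c)"
      by (simp add: fields T_mult_left T_mult algebra_simps)
    also have "\<dots> \<in> N"
      by (intro subgroup.m_closed[OF sub] e d)
    finally show ?thesis
      by (subst M.rcos_eq_iff[OF sub]) simp_all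
  qed
  with e(1) show thesis by (rule that)
qed

section \<open>The two groups of relations\<close>

text \<open>The value at \<open>c\<close> of the linear functional with \<open>t\<^sup>m \<mapsto> \<phi> m\<close>.\<close>

definition pairing :: "(int \<Rightarrow> int) \<Rightarrow> laurent \<Rightarrow> int" where
  "pairing \<phi> c = (\<Sum>m \<in> Poly_Mapping.keys c. Poly_Mapping.lookup c m * \<phi> m)"

lemma pairing_superset:
  assumes "finite A" "Poly_Mapping.keys c \<subseteq> A"
  shows "pairing \<phi> c = (\<Sum>m \<in> A. Poly_Mapping.lookup c m * \<phi> m)"
  unfolding pairing_def by (rule sum.mono_neutral_left) (use assms in \<open>auto simp: in_keys_iff\<close>)

lemma pairing_0 [simp]: "pairing \<phi> 0 = 0"
  by (simp add: pairing_def)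

lemma pairing_T [simp]: "pairing \<phi> (T m) = \<phi> m"
  by (simp add: pairing_def)

lemma pairing_diff: "pairing \<phi> (c - d) = pairing \<phi> c - pairing \<phi> d"
proof -
  let ?A = "Poly_Mapping.keys c \<union> Poly_Mapping.keys d \<union> Poly_Mapping.keys (c - d)"
  have "pairing \<phi> x = (\<Sum>m \<in> ?A. Poly_Mapping.lookup x m * \<phi> m)" if "x \<in> {c, d, c - d}" for x
    by (rule pairing_superset) (use that in auto)
  then show ?thesis
    by (simp add: lookup_minus left_diff_distrib sum_subtractf)
qed

lemma pairing_uminus: "pairing \<phi> (- c) = - pairing \<phi> c"
  using pairing_diff[of \<phi> 0 c] by simp

lemma pairing_add: "pairing \<phi> (c + d) = pairing \<phi> c + pairing \<phi> d"
  using pairing_diff[of \<phi> c "- d"] by (simp add: pairing_uminus)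

lemma pairing_of_nat_times: "pairing \<phi> (of_nat k * c) = int k * pairing \<phi> c"
  by (induction k) (simp_all add: pairing_add distrib_right)

lemma pairing_shift: "pairing \<phi> (T s * c) = pairing (\<lambda>m. \<phi> (m + s)) c"
proof -
  have "diff_closed {c. pairing \<phi> (T s * c) = pairing (\<lambda>m. \<phi> (m + s)) c}"
    by unfold_locales (simp_all add: pairing_diff right_diff_distrib)
  then have "c \<in> {c. pairing \<phi> (T s * c) = pairing (\<lambda>m. \<phi> (m + s)) c}"
    by (rule all_laurent) (simp add: T_mult add.commute)
  then show ?thesis by simp
qed

lemma pairing_sum: "pairing (\<lambda>m. \<Sum>j\<in>J. \<phi> j m) c = (\<Sum>j\<in>J. pairing (\<phi> j) c)"
  unfolding pairing_def by (subst sum.swap) (simp add: sum_distrib_left)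

lemma pairing_add_fun: "pairing (\<lambda>m. \<phi> m + \<psi> m) c = pairing \<phi> c + pairing \<psi> c"
  by (simp add: pairing_def distrib_left sum.distrib)

text \<open>\<open>chi j q\<close> is \<open>0\<close> unless \<open>3\<^sup>j\<close> exactly divides \<open>q\<close>, and then it is the residue \<open>1\<close> or
  \<open>-1\<close> modulo \<open>3\<close> of the cofactor.\<close>

definition chi :: "nat \<Rightarrow> int \<Rightarrow> int" where
  "chi j q = (if \<not> 3 ^ j dvd q then 0
     else if q div 3 ^ j mod 3 = 1 then 1 else if q div 3 ^ j mod 3 = 2 then -1 else 0)"

lemma chi_power_mult: "chi j (3 ^ j * u) = (if u mod 3 = 1 then 1 else if u mod 3 = 2 then -1 else 0)"
  by (simp add: chi_def)

lemma chi_0 [simp]: "chi j 0 = 0"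
  by (simp add: chi_def)

lemma chi_periodic: "3 ^ (j + 1) dvd d \<Longrightarrow> chi j (q + d) = chi j q"
proof -
  assume "3 ^ (j + 1) dvd d"
  then obtain k where d: "d = 3 ^ j * (3 * k)" by (auto simp: mult.assoc)
  then have dvd: "3 ^ j dvd q + d \<longleftrightarrow> 3 ^ j dvd q" by (simp add: dvd_add_left_iff)
  show ?thesis
  proof (cases "3 ^ j dvd q")
    case True
    then obtain u where "q = 3 ^ j * u" by blast
    moreover from this have "q + d = 3 ^ j * (u + 3 * k)" by (simp add: d algebra_simps)
    ultimately show ?thesis by (simp only: chi_power_mult) simp
  next
    case False
    then show ?thesis using dvd by (simp add: chi_def)
  qed
qed

lemma chi_eq_0_of_dvd: "3 ^ (j + 1) dvd q \<Longrightarrow> chi j q = 0"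
  using chi_periodic[of j q 0] by simp

lemma chi_eq_0_of_not_dvd: "\<not> 3 ^ j dvd q \<Longrightarrow> chi j q = 0"
  by (simp add: chi_def)

lemma chi_unique:
  assumes "chi v q \<noteq> 0" "j \<noteq> v"
  shows "chi j q = 0"
proof -
  have 1: "3 ^ v dvd q" using assms(1) chi_eq_0_of_not_dvd by blast
  have 2: "\<not> 3 ^ (v + 1) dvd q" using assms(1) chi_eq_0_of_dvd by blast
  consider "j + 1 \<le> v" | "v + 1 \<le> j" using assms(2) by linarith
  then show ?thesis
  proof cases
    case 1
    then have "3 ^ (j + 1) dvd q" using \<open>3 ^ v dvd q\<close> le_imp_power_dvd dvd_trans by blast
    then show ?thesis by (rule chi_eq_0_of_dvd)
  next
    case 2
    then have "\<not> 3 ^ j dvd q" using \<open>\<not> 3 ^ (v + 1) dvd q\<close> le_imp_power_dvd dvd_trans by blast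
    then show ?thesis by (rule chi_eq_0_of_not_dvd)
  qed
qed

lemma chi_values: "chi j q \<in> {-1, 0, 1}"
  by (simp add: chi_def)

lemma chi_exists:
  assumes "\<not> 3 ^ r dvd q"
  obtains v where "v < r" "chi v q \<noteq> 0"
proof -
  define r' where "r' = (LEAST r. \<not> 3 ^ r dvd q)"
  have r': "\<not> 3 ^ r' dvd q" unfolding r'_def by (rule LeastI[of _ r]) (rule assms)
  have "r' \<le> r" unfolding r'_def by (rule Least_le) (rule assms)
  from r' obtain v where v: "r' = Suc v" by (cases r') auto
  have "3 ^ v dvd q" using not_less_Least[of v "\<lambda>r. \<not> 3 ^ r dvd q"] v by (auto simp: r'_def)
  then obtain u where u: "q = 3 ^ v * u" by blast
  have "\<not> 3 dvd u"
  proof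
    assume "3 dvd u"
    then have "3 ^ v * 3 dvd q" unfolding u by (rule mult_dvd_mono[OF dvd_refl])
    then show False using r' by (simp add: v mult.commute)
  qed
  then have "u mod 3 = 1 \<or> u mod 3 = 2" by presburger
  then have "chi v q \<noteq> 0" unfolding u chi_power_mult by auto
  then show thesis using that[of v] v \<open>r' \<le> r\<close> by simp
qed

text \<open>The relations are given by the functionals that vanish on them rather than by generators:
  this makes them visibly closed in the profinite topology. The last condition is what keeps \<open>t\<^sup>0\<close>
  from becoming trivial when \<open>i = 0\<close>.\<close>

definition relations :: "int \<Rightarrow> laurent set" where
  "relations i = {c. (\<forall>j. pairing (\<lambda>m. chi j (2 * m - i)) c = 0) \<and> even (pairing (\<lambda>_. 1) c)}"

interpretation relations: diff_closed "relations i"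
  by unfold_locales (simp_all add: relations_def pairing_diff)

lemma T_diff_relation:
  assumes "chi v (2 * m - i) = chi v (2 * m' - i)" "chi v (2 * m - i) \<noteq> 0"
  shows "T m - T m' \<in> relations i"
proof -
  have "chi j (2 * m - i) = chi j (2 * m' - i)" for j
    using assms chi_unique[of v _ j] by (cases "j = v") simp_all
  then show ?thesis by (simp add: relations_def pairing_diff)
qed

lemma T_add_relation:
  assumes "chi v (2 * m - i) = - chi v (2 * m' - i)" "chi v (2 * m - i) \<noteq> 0"
  shows "T m + T m' \<in> relations i"
proof -
  have "chi j (2 * m - i) = - chi j (2 * m' - i)" for j
    using assms chi_unique[of v _ j] by (cases "j = v") simp_all
  then show ?thesis by (simp add: relations_def pairing_add)
qed

text \<open>Of the two cofactors \<open>1\<close> and \<open>4\<close>, both congruent to \<open>1\<close> modulo \<open>3\<close>, one has the parity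
  that makes \<open>3\<^sup>v u + i\<close> even.\<close>

lemma exists_exponent_chi_1: "\<exists>m. chi v (2 * m - i) = 1"
proof -
  define u :: int where "u = (if odd i then 1 else 4)"
  have "even (3 ^ v * u + i)" by (simp add: u_def)
  then obtain m where "3 ^ v * u + i = 2 * m" by blast
  then have "2 * m - i = 3 ^ v * u" by simp
  then have "chi v (2 * m - i) = 1" by (simp only: chi_power_mult) (simp add: u_def)
  then show ?thesis ..
qed

text \<open>Here \<open>3\<^sup>r\<close> is the exact power of \<open>3\<close> in the period \<open>e\<close>: a residue class modulo \<open>e\<close> whose
  \<open>2 m - i\<close> are divisible by \<open>3\<^sup>r\<close> contains exponents of either sign at valuation \<open>r\<close>.\<close>

lemma exists_congruent_chi:
  fixes e :: nat
  assumes e: "int e = 3 ^ r * e'" "\<not> 3 dvd e'" and m: "3 ^ r dvd 2 * m - i" and z: "z = 1 \<or> z = -1"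
  shows "\<exists>l. chi r (2 * (m + int e * l) - i) = z"
proof -
  obtain w where w: "2 * m - i = 3 ^ r * w" using m by blast
  have eq: "2 * (m + int e * l) - i = 3 ^ r * (w + 2 * e' * l)" for l
    using w by (simp add: e algebra_simps)
  have "\<exists>l. (w + 2 * e' * l) mod 3 = z mod 3"
  proof -
    have "w mod 3 = z mod 3 \<or> (w + 2 * e') mod 3 = z mod 3 \<or> (w + 4 * e') mod 3 = z mod 3"
      using e(2) by presburger
    then show ?thesis
      by (elim disjE) (rule exI[of _ 0] exI[of _ 1] exI[of _ 2], simp add: algebra_simps)+
  qed
  then obtain l where "(w + 2 * e' * l) mod 3 = z mod 3" ..
  then have "chi r (2 * (m + int e * l) - i) = z"
    unfolding eq chi_power_mult using z by auto
  then show ?thesis ..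
qed

text \<open>Modulo \<open>relations i\<close> and periodicity, \<open>t\<^sup>m\<close> only depends on the class of \<open>2 m - i\<close>, where all
  multiples of \<open>3\<^sup>r\<close> have fallen into one class \<open>\<kappa>\<close>. As that class contains numbers of either sign,
  \<open>\<kappa>\<close> is its own negative.\<close>

lemma periodic_normal_form:
  assumes A: "diff_closed (A :: laurent set)"
    and per: "\<And>n b. int e dvd n \<Longrightarrow> T n * b - b \<in> A"
    and e: "int e = 3 ^ r * e'" "\<not> 3 dvd e'"
    and rel: "relations i \<subseteq> A"
  obtains p \<kappa> where "2 * \<kappa> \<in> A"
    "\<And>m. T m - ((\<Sum>v<r. of_int (chi v (2 * m - i)) * p v) + \<kappa>) \<in> A"
proof -
  interpret A: diff_closed A by fact
  have "\<forall>v. \<exists>m. chi v (2 * m - i) = 1" using exists_exponent_chi_1 by blast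
  then obtain M where M: "\<And>v. chi v (2 * M v - i) = 1" by metis
  define \<kappa> where "\<kappa> = T (M r)"
  have move: "T (m + int e * l) - T m \<in> A" for m l
    using per[of "int e * l" "T m"] by (simp add: T_mult add.commute)
  have far: "T m - \<kappa> \<in> A" if div: "3 ^ r dvd 2 * m - i" for m
  proof -
    obtain l where "chi r (2 * (m + int e * l) - i) = 1"
      using exists_congruent_chi[OF e div] by blast
    then have "T (m + int e * l) - \<kappa> \<in> A"
      unfolding \<kappa>_def using T_diff_relation[of r "m + int e * l" i "M r"] M rel by auto
    then show ?thesis using A.diff[OF _ move, of "T (m + int e * l) - \<kappa>" m l] by simp
  qed
  have "3 ^ r dvd 2 * M r - i" using M[of r] chi_eq_0_of_not_dvd by fastforce
  then obtain l where l: "chi r (2 * (M r + int e * l) - i) = -1"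
    using exists_congruent_chi[OF e] by blast
  have "T (M r + int e * l) + \<kappa> \<in> A"
    unfolding \<kappa>_def using T_add_relation[of r "M r + int e * l" i "M r"] M l rel by auto
  from A.diff[OF this move[of "M r" l]] have \<kappa>2: "2 * \<kappa> \<in> A"
    by (simp add: \<kappa>_def)
  \<comment> \<open>Adding \<open>\<kappa>\<close> to each \<open>t\<^sup>M\<^sup>v\<close> compensates for the constant term \<open>\<kappa>\<close>, up to multiples of \<open>2 \<kappa>\<close>.\<close>
  moreover have "T m - ((\<Sum>v<r. of_int (chi v (2 * m - i)) * (T (M v) + \<kappa>)) + \<kappa>) \<in> A" for m
  proof (cases "3 ^ r dvd 2 * m - i")
    case True
    have "chi v (2 * m - i) = 0" if "v < r" for v
      using that True le_imp_power_dvd[of "v + 1" r 3] by (intro chi_eq_0_of_dvd) (auto intro: dvd_trans)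
    then show ?thesis using far[OF True] by simp
  next
    case False
    then obtain v where v: "v < r" "chi v (2 * m - i) \<noteq> 0" by (rule chi_exists)
    have "(\<Sum>w<r. of_int (chi w (2 * m - i)) * (T (M w) + \<kappa>))
        = (\<Sum>w<r. if w = v then of_int (chi v (2 * m - i)) * (T (M v) + \<kappa>) else 0)"
      by (rule sum.cong) (use chi_unique[OF v(2)] in auto)
    then have sum: "(\<Sum>w<r. of_int (chi w (2 * m - i)) * (T (M w) + \<kappa>))
        = of_int (chi v (2 * m - i)) * (T (M v) + \<kappa>)" using v(1) by simp
    consider "chi v (2 * m - i) = 1" | "chi v (2 * m - i) = -1"
      using chi_values[of v "2 * m - i"] v(2) by auto
    then show ?thesis
    proof cases
      case 1
      then have "T m - T (M v) \<in> A"
        using T_diff_relation[of v m i "M v"] M rel by auto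
      from A.diff[OF this \<kappa>2] show ?thesis unfolding sum 1 by (simp add: algebra_simps)
    next
      case 2
      then have "T m + T (M v) \<in> A"
        using T_add_relation[of v m i "M v"] M rel by auto
      then show ?thesis unfolding sum 2 by (simp add: algebra_simps)
    qed
  qed
  ultimately show thesis by (rule that)
qed

text \<open>The normal form of \<open>t\<^sup>m\<close> is linear in the pairings that define the relations and in the
  augmentation, the latter with a coefficient \<open>\<kappa>\<close> of order two. After a shift of exponents by \<open>s\<close>
  with \<open>2 s \<equiv> i - i'\<close> modulo \<open>3\<^sup>r\<close> these pairings become those for \<open>i'\<close>.\<close>

lemma shifted_relations:
  assumes A: "diff_closed (A :: laurent set)"
    and per: "\<And>n b. int e dvd n \<Longrightarrow> T n * b - b \<in> A"
    and e: "int e = 3 ^ r * e'" "\<not> 3 dvd e'"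
    and rel: "relations i \<subseteq> A" and s: "3 ^ r dvd 2 * s - i + i'" and c: "c \<in> relations i'"
  shows "T s * c \<in> A"
proof -
  interpret A: diff_closed A by fact
  obtain p \<kappa> where \<kappa>: "2 * \<kappa> \<in> A"
    and nf: "\<And>m. T m - ((\<Sum>v<r. of_int (chi v (2 * m - i)) * p v) + \<kappa>) \<in> A"
    by (rule periodic_normal_form[OF A _ e rel]) (rule per, assumption, rule that)
  \<comment> \<open>the linear extension of the normal form of \<open>t\<^sup>m\<^sup>+\<^sup>s\<close>\<close>
  define F where "F c = (\<Sum>v<r. of_int (pairing (\<lambda>m. chi v (2 * m - i')) c) * p v)
      + of_int (pairing (\<lambda>_. 1) c) * \<kappa>" for c
  have F_diff: "F (c - d) = F c - F d" for c d
    by (simp add: F_def pairing_diff left_diff_distrib sum_subtractf)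
  interpret B: diff_closed "{c. T s * c - F c \<in> A}"
  proof
    show "0 \<in> {c. T s * c - F c \<in> A}" using A.zero by (simp add: F_def)
    fix c d assume "c \<in> {c. T s * c - F c \<in> A}" "d \<in> {c. T s * c - F c \<in> A}"
    then show "c - d \<in> {c. T s * c - F c \<in> A}"
      using A.diff[of "T s * c - F c" "T s * d - F d"] by (simp add: F_diff algebra_simps)
  qed
  have "T s * c - F c \<in> A"
  proof -
    have "T s * T m - F (T m) \<in> A" for m
    proof -
      have "chi v (2 * m - i') = chi v (2 * (m + s) - i)" if "v < r" for v
      proof -
        have "3 ^ (v + 1) dvd 2 * s - i + i'"
          using that s le_imp_power_dvd[of "v + 1" r "3::int"] by (auto intro: dvd_trans)
        from chi_periodic[OF this, of "2 * m - i'"] show ?thesis by (simp add: algebra_simps)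
      qed
      then have "F (T m) = (\<Sum>v<r. of_int (chi v (2 * (m + s) - i)) * p v) + \<kappa>"
        by (simp add: F_def)
      then show ?thesis using nf[of "m + s"] by (simp add: T_mult add.commute)
    qed
    then show ?thesis using all_laurent[OF B.diff_closed_axioms] by simp
  qed
  moreover have "F c \<in> A"
  proof -
    obtain k where "pairing (\<lambda>_. 1) c = 2 * k" using c by (auto simp: relations_def)
    moreover have "pairing (\<lambda>m. chi v (2 * m - i')) c = 0" for v
      using c by (simp add: relations_def)
    ultimately have "F c = of_int k * (2 * \<kappa>)" by (simp add: F_def algebra_simps)
    then show ?thesis using A.of_int_times[OF \<kappa>] by simp
  qed
  ultimately show ?thesis using A.add by fastforce
qed

definition central :: "laurent set \<Rightarrow> mat set" where
  "central D = {(0, 0, 0, c) | c. c \<in> D}"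

lemma central_mem [simp]: "(a, n, b, c) \<in> central D \<longleftrightarrow> a = 0 \<and> n = 0 \<and> b = 0 \<and> c \<in> D"
  by (auto simp: central_def)

lemma central_normal:
  assumes "diff_closed D"
  shows "central D \<lhd> mat_group"
proof -
  interpret D: diff_closed D by fact
  have sub: "subgroup (central D) mat_group"
  proof
    show "\<one>\<^bsub>mat_group\<^esub> \<in> central D" by (simp add: D.zero)
    fix x y assume "x \<in> central D" "y \<in> central D"
    then show "x \<otimes>\<^bsub>mat_group\<^esub> y \<in> central D" "inv\<^bsub>mat_group\<^esub> x \<in> central D"
      by (auto simp: central_def D.add D.neg)
  qed simp
  show ?thesis
    unfolding M.normal_inv_iff
  proof (intro conjI ballI sub)
    fix g x assume "x \<in> central D"
    then obtain c where x: "x = (0, 0, 0, c)" "c \<in> D" by (auto simp: central_def)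
    have "g \<otimes>\<^bsub>mat_group\<^esub> x \<otimes>\<^bsub>mat_group\<^esub> inv\<^bsub>mat_group\<^esub> g = x"
      by (cases g) (simp add: x(1) T_mult mult.assoc T_mult_left)
    then show "g \<otimes>\<^bsub>mat_group\<^esub> x \<otimes>\<^bsub>mat_group\<^esub> inv\<^bsub>mat_group\<^esub> g \<in> central D"
      using x by simp
  qed
qed

section \<open>Residual finiteness\<close>

lemma (in group_hom) image_finite_index:
  assumes N: "N \<in> finite_index_normal_subgroups G" and surj: "h ` carrier G = carrier H"
  shows "h ` N \<in> finite_index_normal_subgroups H"
proof -
  interpret N: normal N G by (rule G.finite_index_normalD(1)[OF N])
  have "h ` N \<lhd> H"
    by (rule N.surj_hom_normal_subgroup[OF group_hom_axioms surj])
  moreover have "rcosets\<^bsub>H\<^esub> (h ` N) \<subseteq> (\<lambda>C. h ` C) ` (rcosets\<^bsub>G\<^esub> N)"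
  proof
    fix C assume "C \<in> rcosets\<^bsub>H\<^esub> (h ` N)"
    then obtain x where x: "x \<in> carrier G" "C = h ` N #>\<^bsub>H\<^esub> h x"
      unfolding RCOSETS_def surj[symmetric] by auto
    have "h (n \<otimes> x) = h n \<otimes>\<^bsub>H\<^esub> h x" if "n \<in> N" for n
      using N.mem_carrier[OF that] x(1) by simp
    then have "C = h ` (N #> x)"
      unfolding x(2) r_coset_def image_UN by simp
    then show "C \<in> (\<lambda>C. h ` C) ` (rcosets\<^bsub>G\<^esub> N)"
      using x(1) G.rcosetsI[OF N.subset] by blast
  qed
  ultimately show ?thesis
    using N finite_subset finite_imageI unfolding finite_index_normal_subgroups_def by blast
qed

lemma (in group_hom) residually_finite_image:
  assumes surj: "h ` carrier G = carrier H"
    and sep: "\<And>x. x \<in> carrier G \<Longrightarrow> x \<notin> kernel G H h \<Longrightarrow>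
      \<exists>N \<in> finite_index_normal_subgroups G. kernel G H h \<subseteq> N \<and> x \<notin> N"
  shows "residually_finite_group H"
  unfolding residually_finite_group_def
proof (intro conjI ballI impI)
  show "group H" ..
  fix y assume y: "y \<in> carrier H" "y \<noteq> \<one>\<^bsub>H\<^esub>"
  then obtain x where x: "x \<in> carrier G" "y = h x"
    unfolding surj[symmetric] by blast
  then have "x \<notin> kernel G H h"
    using y(2) by (simp add: kernel_def)
  note x = x this
  obtain N where N: "N \<in> finite_index_normal_subgroups G" "kernel G H h \<subseteq> N" "x \<notin> N"
    using sep[OF x(1,3)] by blast
  interpret N: normal N G by (rule G.finite_index_normalD(1)[OF N(1)])
  have "h x \<notin> h ` N"
  proof
    assume "h x \<in> h ` N"
    then obtain n where n: "n \<in> N" "h x = h n" by blast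
    have nG: "n \<in> carrier G" using n(1) N.mem_carrier by blast
    then have "x \<otimes> inv n \<in> kernel G H h"
      using x(1) n(2) by (simp add: kernel_def)
    then have "x \<otimes> inv n \<otimes> n \<in> N"
      using N(2) n(1) N.m_closed by blast
    then show False
      using N(3) x(1) nG by (simp add: G.m_assoc)
  qed
  then show "\<exists>N \<in> finite_index_normal_subgroups H. y \<notin> N"
    using image_finite_index[OF N(1) surj] x(2) by blast
qed

lemma (in group) finite_index_of_finite_valued:
  assumes N: "N \<lhd> G" and "finite (f ` carrier G)"
    and f: "\<And>x y. x \<in> carrier G \<Longrightarrow> y \<in> carrier G \<Longrightarrow> f x = f y \<Longrightarrow> x \<otimes> inv y \<in> N"
  shows "N \<in> finite_index_normal_subgroups G"
proof -
  have sub: "subgroup N G" using N by (rule normal_imp_subgroup)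
  define g where "g v = N #> (SOME x. x \<in> carrier G \<and> f x = v)" for v
  have "rcosets N \<subseteq> g ` f ` carrier G"
  proof
    fix C assume "C \<in> rcosets N"
    then obtain x where x: "x \<in> carrier G" "C = N #> x" by (auto simp: RCOSETS_def)
    define y where "y = (SOME y. y \<in> carrier G \<and> f y = f x)"
    have y: "y \<in> carrier G \<and> f y = f x"
      unfolding y_def by (rule someI[of _ x]) (use x in simp)
    then have "C = N #> y"
      using rcos_eq_iff[OF sub x(1), of y] f[OF x(1), of y] x(2) by simp
    then have "C = g (f x)" by (simp add: g_def y_def)
    then show "C \<in> g ` f ` carrier G" using x(1) by blast
  qed
  then show ?thesis
    using N finite_subset[OF _ finite_imageI[OF assms(2)]]
    by (auto simp: finite_index_normal_subgroups_def)
qed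

lemma pairing_scale: "pairing (\<lambda>m. v * \<phi> m) c = v * pairing \<phi> c"
  by (simp add: pairing_def sum_distrib_left mult.left_commute)

text \<open>The ideal of \<open>t\<^sup>e - 1\<close> and \<open>k\<close>, described by the linear functionals that vanish on it.\<close>

definition periodic_ideal :: "int \<Rightarrow> int \<Rightarrow> laurent set" where
  "periodic_ideal e k = {a. \<forall>\<psi>. (\<forall>m. \<psi> (m + e) = \<psi> m) \<longrightarrow> k dvd pairing \<psi> a}"

lemma periodic_add_mult:
  fixes \<psi> :: "int \<Rightarrow> 'a" and e l :: int
  assumes "\<And>m. \<psi> (m + e) = \<psi> m"
  shows "\<psi> (m + e * l) = \<psi> m"
proof (induction l rule: int_induct[of _ 0])
  case (step1 i)
  then show ?case using assms[of "m + e * i"] by (simp add: algebra_simps)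
next
  case (step2 i)
  then show ?case using assms[of "m + e * (i - 1)"] by (simp add: algebra_simps)
qed simp

lemma periodic_mod:
  fixes \<psi> :: "int \<Rightarrow> 'a" and e :: int
  assumes "\<And>m. \<psi> (m + e) = \<psi> m"
  shows "\<psi> (m mod e) = \<psi> m"
  using periodic_add_mult[of \<psi> e "m mod e" "m div e", OF assms] by (simp add: mult.commute)

interpretation periodic_ideal: diff_closed "periodic_ideal e k"
  by unfold_locales (simp_all add: periodic_ideal_def pairing_diff)

lemma periodic_ideal_shift: "a \<in> periodic_ideal e k \<Longrightarrow> T s * a \<in> periodic_ideal e k"
  unfolding periodic_ideal_def
proof (intro CollectI allI impI)
  fix \<psi> :: "int \<Rightarrow> int"
  assume a: "a \<in> {a. \<forall>\<psi>. (\<forall>m. \<psi> (m + e) = \<psi> m) \<longrightarrow> k dvd pairing \<psi> a}"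
    and \<psi>: "\<forall>m. \<psi> (m + e) = \<psi> m"
  have "\<forall>m. \<psi> (m + e + s) = \<psi> (m + s)" using \<psi> by (metis add.assoc add.commute)
  with a show "k dvd pairing \<psi> (T s * a)" by (simp add: pairing_shift)
qed

lemma periodic_ideal_mult:
  assumes "a \<in> periodic_ideal e k"
  shows "b * a \<in> periodic_ideal e k"
proof -
  have "diff_closed {b. b * a \<in> periodic_ideal e k}"
    by unfold_locales (simp_all add: periodic_ideal.zero periodic_ideal.diff left_diff_distrib)
  from all_laurent[OF this] show ?thesis
    using periodic_ideal_shift[OF assms] by simp
qed

lemma periodic_ideal_mult': "a \<in> periodic_ideal e k \<Longrightarrow> a * b \<in> periodic_ideal e k"
  using periodic_ideal_mult[of a e k b] by (simp add: mult.commute)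

lemma T_minus_1_mem: "e dvd n \<Longrightarrow> T n - 1 \<in> periodic_ideal e k"
proof -
  assume "e dvd n"
  then obtain l where n: "n = e * l" by blast
  show ?thesis
    unfolding periodic_ideal_def
  proof (intro CollectI allI impI)
    fix \<psi> :: "int \<Rightarrow> int" assume "\<forall>m. \<psi> (m + e) = \<psi> m"
    then have "\<psi> n = \<psi> 0"
      using periodic_add_mult[of \<psi> e 0 l] by (simp add: n)
    moreover have "pairing \<psi> 1 = \<psi> 0" using pairing_T[of \<psi> 0] by simp
    ultimately show "k dvd pairing \<psi> (T n - 1)" by (simp add: pairing_diff)
  qed
qed

definition congruence_subgroup :: "int \<Rightarrow> int \<Rightarrow> (int \<Rightarrow> int) \<Rightarrow> mat set" where
  "congruence_subgroup e k \<phi> =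
     {(a, n, b, c). a \<in> periodic_ideal e k \<and> e dvd n \<and> b \<in> periodic_ideal e k \<and> k dvd pairing \<phi> c}"

text \<open>Periodicity of \<open>\<phi>\<close> makes the condition on \<open>c\<close> insensitive to the ideal, in which all the
  products occurring in a conjugate lie. A coset is determined by finitely many residues modulo
  \<open>k\<close> and \<open>e\<close>.\<close>

lemma congruence_subgroup_finite_index:
  assumes e: "e > 0" and k: "k > 0" and \<phi>: "\<And>m. \<phi> (m + e) = \<phi> m"
  shows "congruence_subgroup e k \<phi> \<in> finite_index_normal_subgroups mat_group"
proof -
  have \<phi>_ideal: "k dvd pairing \<phi> a" if "a \<in> periodic_ideal e k" for a
    using that \<phi> by (simp add: periodic_ideal_def)
  note closure = periodic_ideal.zero periodic_ideal.add periodic_ideal.diff periodic_ideal.neg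
    periodic_ideal_mult periodic_ideal_mult'
  have sub: "subgroup (congruence_subgroup e k \<phi>) mat_group"
  proof
    show "\<one>\<^bsub>mat_group\<^esub> \<in> congruence_subgroup e k \<phi>"
      by (simp add: congruence_subgroup_def closure)
    fix x y assume x: "x \<in> congruence_subgroup e k \<phi>" and y: "y \<in> congruence_subgroup e k \<phi>"
    show "x \<otimes>\<^bsub>mat_group\<^esub> y \<in> congruence_subgroup e k \<phi>"
      using x y by (cases x, cases y)
        (simp add: congruence_subgroup_def closure pairing_add \<phi>_ideal)
    show "inv\<^bsub>mat_group\<^esub> x \<in> congruence_subgroup e k \<phi>"
      using x by (cases x)
        (simp add: congruence_subgroup_def closure pairing_diff \<phi>_ideal)
  qed simp
  have normal: "congruence_subgroup e k \<phi> \<lhd> mat_group"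
    unfolding M.normal_inv_iff
  proof (intro conjI ballI sub)
    fix g x assume x: "x \<in> congruence_subgroup e k \<phi>"
    show "g \<otimes>\<^bsub>mat_group\<^esub> x \<otimes>\<^bsub>mat_group\<^esub> inv\<^bsub>mat_group\<^esub> g \<in> congruence_subgroup e k \<phi>"
    proof (cases g, cases x)
      fix a' n' b' c' a n b c
      assume g_eq: "g = (a', n', b', c')" and x_eq: "x = (a, n, b, c)"
      have abc: "a \<in> periodic_ideal e k" "e dvd n" "b \<in> periodic_ideal e k" "k dvd pairing \<phi> c"
        using x by (simp_all add: x_eq congruence_subgroup_def)
      \<comment> \<open>the conjugate, found by solving \<open>g x = (A, n, B, C) g\<close> entry by entry\<close>
      define A where "A = T (- n') * (a + a' * (T n - 1))"
      define B where "B = T n' * b - (T n - 1) * b'"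
      define C where "C = c + a' * b - A * b'"
      have A: "A \<in> periodic_ideal e k" and B: "B \<in> periodic_ideal e k"
        using abc by (simp_all add: A_def B_def closure T_minus_1_mem)
      then have "k dvd pairing \<phi> C"
        using abc by (simp add: C_def closure \<phi>_ideal pairing_add pairing_diff)
      then have mem: "(A, n, B, C) \<in> congruence_subgroup e k \<phi>"
        using A B abc by (simp add: congruence_subgroup_def)
      have "A * T n' = a + a' * (T n - 1)"
        by (simp add: A_def mult.commute[of _ "T n'"] T_mult_left)
      then have "g \<otimes>\<^bsub>mat_group\<^esub> x = (A, n, B, C) \<otimes>\<^bsub>mat_group\<^esub> g"
        by (simp add: g_eq x_eq B_def C_def algebra_simps)
      then have "g \<otimes>\<^bsub>mat_group\<^esub> x \<otimes>\<^bsub>mat_group\<^esub> inv\<^bsub>mat_group\<^esub> g = (A, n, B, C)"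
        using M.inv_solve_right[of "(A, n, B, C)" "g \<otimes>\<^bsub>mat_group\<^esub> x" g] by simp
      then show ?thesis using mem by (simp only:)
    qed
  qed
  define res where "res a = (\<lambda>\<rho> \<in> {0..<e}. pairing (\<lambda>m. of_bool (m mod e = \<rho>)) a mod k)" for a
  define f where "f = (\<lambda>(a, n, b, c). (res a, n mod e, res b, pairing \<phi> c mod k))"
  have res_fin: "res a \<in> {0..<e} \<rightarrow>\<^sub>E {0..<k}" for a
    using k by (auto simp: res_def)
  have res_eq: "a - a' \<in> periodic_ideal e k" if eq: "res a = res a'" for a a'
    unfolding periodic_ideal_def
  proof (intro CollectI allI impI)
    fix \<psi> :: "int \<Rightarrow> int" assume \<psi>: "\<forall>m. \<psi> (m + e) = \<psi> m"
    have dvd: "k dvd pairing (\<lambda>m. of_bool (m mod e = \<rho>)) (a - a')" if "\<rho> \<in> {0..<e}" for \<rho>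
      using fun_cong[OF eq, of \<rho>] that by (simp add: res_def pairing_diff mod_eq_dvd_iff)
    have "\<psi> m = (\<Sum>\<rho> \<in> {0..<e}. \<psi> \<rho> * of_bool (m mod e = \<rho>))" for m
    proof -
      have "(\<Sum>\<rho> \<in> {0..<e}. \<psi> \<rho> * of_bool (m mod e = \<rho>)) = (\<Sum>\<rho> \<in> {0..<e}. if m mod e = \<rho> then \<psi> \<rho> else 0)"
        by (rule sum.cong) auto
      also have "\<dots> = \<psi> (m mod e)" using e by (simp add: sum.delta)
      also have "\<dots> = \<psi> m" using periodic_mod[of \<psi> e m] \<psi> by simp
      finally show ?thesis ..
    qed
    then have "pairing \<psi> (a - a')
        = pairing (\<lambda>m. \<Sum>\<rho> \<in> {0..<e}. \<psi> \<rho> * of_bool (m mod e = \<rho>)) (a - a')"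
      by (metis (no_types, lifting))
    also have "\<dots> = (\<Sum>\<rho> \<in> {0..<e}. \<psi> \<rho> * pairing (\<lambda>m. of_bool (m mod e = \<rho>)) (a - a'))"
      by (simp only: pairing_sum pairing_scale)
    also have "k dvd \<dots>" by (intro dvd_sum dvd_mult dvd)
    finally show "k dvd pairing \<psi> (a - a')" .
  qed
  show ?thesis
  proof (rule M.finite_index_of_finite_valued[OF normal])
    have "f ` carrier mat_group
        \<subseteq> ({0..<e} \<rightarrow>\<^sub>E {0..<k}) \<times> {0..<e} \<times> ({0..<e} \<rightarrow>\<^sub>E {0..<k}) \<times> {0..<k}"
      using res_fin e k by (auto simp: f_def)
    then show "finite (f ` carrier mat_group)"
      by (rule finite_subset) (intro finite_cartesian_product finite_PiE, simp_all)
    fix x y assume eq: "f x = f y"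
    show "x \<otimes>\<^bsub>mat_group\<^esub> inv\<^bsub>mat_group\<^esub> y \<in> congruence_subgroup e k \<phi>"
    proof (cases x, cases y)
      fix a n b c a' n' b' c'
      assume x: "x = (a, n, b, c)" and y: "y = (a', n', b', c')"
      have I: "a - a' \<in> periodic_ideal e k" "b - b' \<in> periodic_ideal e k" "e dvd n - n'"
          "k dvd pairing \<phi> (c - c')"
        using eq by (auto simp: f_def x y res_eq mod_eq_dvd_iff pairing_diff)
      \<comment> \<open>splitting off the entries \<open>b\<close> and \<open>c\<close> makes the differences of entries appear\<close>
      have "x \<otimes>\<^bsub>mat_group\<^esub> inv\<^bsub>mat_group\<^esub> y = (0, 0, b, c) \<otimes>\<^bsub>mat_group\<^esub>
          ((a - a') * T (- n'), n - n', 0, 0) \<otimes>\<^bsub>mat_group\<^esub> inv\<^bsub>mat_group\<^esub> (0, 0, b', c')"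
        by (simp add: x y algebra_simps T_mult T_mult_left)
      then have "x \<otimes>\<^bsub>mat_group\<^esub> inv\<^bsub>mat_group\<^esub> y
          = ((a - a') * T (- n'), n - n', (b - b') - (T (n - n') - 1) * b',
             (c - c') - (a - a') * T (- n') * b')"
        by (simp add: algebra_simps)
      then show ?thesis
        using I by (simp add: congruence_subgroup_def closure T_minus_1_mem \<phi>_ideal pairing_diff)
    qed
  qed
qed

text \<open>A period larger than the diameter of the support isolates a single coefficient.\<close>

lemma separate_from_0:
  assumes "a \<noteq> 0"
  obtains e k where "e > 0" "k > 0" "a \<notin> periodic_ideal e k"
proof -
  obtain m where m: "Poly_Mapping.lookup a m \<noteq> 0"
    using assms by (metis lookup_zero poly_mapping_eqI)
  define u where "u = Max ((\<lambda>l. \<bar>l\<bar>) ` Poly_Mapping.keys a)"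
  have u: "\<bar>l\<bar> \<le> u" if "l \<in> Poly_Mapping.keys a" for l
    unfolding u_def using that by (intro Max_ge) simp_all
  have mk: "m \<in> Poly_Mapping.keys a" using m by (simp add: in_keys_iff)
  define e where "e = 2 * u + 1"
  define k where "k = \<bar>Poly_Mapping.lookup a m\<bar> + 1"
  have e: "e > 0" using u[OF mk] by (simp add: e_def)
  have inj: "l = m" if l: "l \<in> Poly_Mapping.keys a" "l mod e = m mod e" for l
  proof -
    have "e dvd l - m" using l(2) by (simp add: mod_eq_dvd_iff)
    moreover have "\<bar>l - m\<bar> < e" using u[OF l(1)] u[OF mk] by (simp add: e_def)
    ultimately show ?thesis using dvd_imp_le_int[of "l - m" e] by fastforce
  qed
  have "pairing (\<lambda>l. of_bool (l mod e = m mod e)) a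
      = (\<Sum>l \<in> Poly_Mapping.keys a. if l = m then Poly_Mapping.lookup a m else 0)"
    unfolding pairing_def by (rule sum.cong) (use inj in auto)
  also have "\<dots> = Poly_Mapping.lookup a m" using mk by simp
  finally have p: "pairing (\<lambda>l. of_bool (l mod e = m mod e)) a = Poly_Mapping.lookup a m" .
  have "\<not> k dvd Poly_Mapping.lookup a m"
    using m dvd_imp_le_int[of "Poly_Mapping.lookup a m" k] by (auto simp: k_def)
  then have "a \<notin> periodic_ideal e k"
    using p by (auto simp: periodic_ideal_def intro!: exI[of _ "\<lambda>l. of_bool (l mod e = m mod e)"])
  then show thesis using that[of e k] e by (simp add: k_def)
qed

text \<open>The functionals defining the relations are periodic: \<open>chi j\<close> has period \<open>3\<^sup>j\<^sup>+\<^sup>1\<close>, and the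
  augmentation has period \<open>1\<close>.\<close>

lemma separate_central_relations:
  assumes x: "x \<notin> central (relations i)"
  shows "\<exists>N \<in> finite_index_normal_subgroups mat_group. central (relations i) \<subseteq> N \<and> x \<notin> N"
proof -
  have 0: "pairing (\<lambda>_. 0) c = 0" for c by (simp add: pairing_def)
  have incl: "central (relations i) \<subseteq> congruence_subgroup e k \<phi>"
    if "\<And>c. c \<in> relations i \<Longrightarrow> k dvd pairing \<phi> c" for e k \<phi>
    using that by (auto simp: central_def congruence_subgroup_def periodic_ideal.zero)
  obtain a n b c where x_eq: "x = (a, n, b, c)" by (cases x)
  consider "n \<noteq> 0" | "a \<noteq> 0" | "b \<noteq> 0"
    | j where "n = 0" "a = 0" "b = 0" "pairing (\<lambda>m. chi j (2 * m - i)) c \<noteq> 0"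
    | "n = 0" "a = 0" "b = 0" "odd (pairing (\<lambda>_. 1) c)"
    using x by (auto simp: x_eq relations_def)
  then show ?thesis
  proof cases
    case 1
    have "\<not> \<bar>n\<bar> + 1 dvd n" using dvd_imp_le_int[OF 1, of "\<bar>n\<bar> + 1"] by auto
    then have "x \<notin> congruence_subgroup (\<bar>n\<bar> + 1) 1 (\<lambda>_. 0)"
      by (simp add: x_eq congruence_subgroup_def)
    moreover have "congruence_subgroup (\<bar>n\<bar> + 1) 1 (\<lambda>_. 0) \<in> finite_index_normal_subgroups mat_group"
      by (rule congruence_subgroup_finite_index) simp_all
    moreover have "central (relations i) \<subseteq> congruence_subgroup (\<bar>n\<bar> + 1) 1 (\<lambda>_. 0)"
      by (rule incl) simp
    ultimately show ?thesis by (intro bexI conjI)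
  next
    case 2
    obtain e k where ek: "e > 0" "k > 0" "a \<notin> periodic_ideal e k" using separate_from_0[OF 2] .
    from ek(3) have "x \<notin> congruence_subgroup e k (\<lambda>_. 0)"
      by (simp add: x_eq congruence_subgroup_def)
    moreover have "congruence_subgroup e k (\<lambda>_. 0) \<in> finite_index_normal_subgroups mat_group"
      by (rule congruence_subgroup_finite_index) (simp_all add: ek)
    moreover have "central (relations i) \<subseteq> congruence_subgroup e k (\<lambda>_. 0)"
      by (rule incl) (simp add: 0)
    ultimately show ?thesis by (intro bexI conjI)
  next
    case 3
    obtain e k where ek: "e > 0" "k > 0" "b \<notin> periodic_ideal e k" using separate_from_0[OF 3] .
    from ek(3) have "x \<notin> congruence_subgroup e k (\<lambda>_. 0)"
      by (simp add: x_eq congruence_subgroup_def)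
    moreover have "congruence_subgroup e k (\<lambda>_. 0) \<in> finite_index_normal_subgroups mat_group"
      by (rule congruence_subgroup_finite_index) (simp_all add: ek)
    moreover have "central (relations i) \<subseteq> congruence_subgroup e k (\<lambda>_. 0)"
      by (rule incl) (simp add: 0)
    ultimately show ?thesis by (intro bexI conjI)
  next
    case (4 j)
    define w where "w = pairing (\<lambda>m. chi j (2 * m - i)) c"
    have "\<not> \<bar>w\<bar> + 1 dvd w" using dvd_imp_le_int[of w "\<bar>w\<bar> + 1"] 4(4) by (auto simp: w_def)
    then have "x \<notin> congruence_subgroup (3 ^ (j + 1)) (\<bar>w\<bar> + 1) (\<lambda>m. chi j (2 * m - i))"
      by (simp add: x_eq congruence_subgroup_def w_def)
    moreover have "chi j (2 * (m + 3 ^ (j + 1)) - i) = chi j (2 * m - i)" for m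
      using chi_periodic[of j "2 * 3 ^ (j + 1)" "2 * m - i"] by (simp add: algebra_simps)
    then have "congruence_subgroup (3 ^ (j + 1)) (\<bar>w\<bar> + 1) (\<lambda>m. chi j (2 * m - i))
        \<in> finite_index_normal_subgroups mat_group"
      by (intro congruence_subgroup_finite_index) simp_all
    moreover have "central (relations i)
        \<subseteq> congruence_subgroup (3 ^ (j + 1)) (\<bar>w\<bar> + 1) (\<lambda>m. chi j (2 * m - i))"
      by (rule incl) (simp add: relations_def)
    ultimately show ?thesis by (intro bexI conjI)
  next
    case 5
    then have "x \<notin> congruence_subgroup 1 2 (\<lambda>_. 1)"
      by (simp add: x_eq congruence_subgroup_def)
    moreover have "central (relations i) \<subseteq> congruence_subgroup 1 2 (\<lambda>_. 1)"
      by (rule incl) (simp add: relations_def)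
    moreover have "congruence_subgroup 1 2 (\<lambda>_. 1) \<in> finite_index_normal_subgroups mat_group"
      by (rule congruence_subgroup_finite_index) simp_all
    ultimately show ?thesis by (intro bexI conjI)
  qed
qed

section \<open>Generalized torsion\<close>

definition conj_product :: "('a, 'b) monoid_scheme \<Rightarrow> 'a \<Rightarrow> 'a list \<Rightarrow> 'a" where
  "conj_product G g gs = foldr (\<otimes>\<^bsub>G\<^esub>) (map (\<lambda>h. inv\<^bsub>G\<^esub> h \<otimes>\<^bsub>G\<^esub> g \<otimes>\<^bsub>G\<^esub> h) gs) \<one>\<^bsub>G\<^esub>"

lemma conj_product_simps [simp]:
  "conj_product G g [] = \<one>\<^bsub>G\<^esub>"
  "conj_product G g (h # hs) = (inv\<^bsub>G\<^esub> h \<otimes>\<^bsub>G\<^esub> g \<otimes>\<^bsub>G\<^esub> h) \<otimes>\<^bsub>G\<^esub> conj_product G g hs"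
  by (simp_all add: conj_product_def)

lemma (in group) conj_product_closed:
  "g \<in> carrier G \<Longrightarrow> set hs \<subseteq> carrier G \<Longrightarrow> conj_product G g hs \<in> carrier G"
  by (induction hs) simp_all

lemma (in group_hom) hom_conj_product:
  "g \<in> carrier G \<Longrightarrow> set hs \<subseteq> carrier G \<Longrightarrow> h (conj_product G g hs) = conj_product H (h g) (map h hs)"
  by (induction hs) (simp_all add: G.conj_product_closed)

text \<open>This allows products of conjugates in a quotient to be computed with matrices.\<close>

lemma (in group_hom) has_generalized_torsion_image_iff:
  assumes surj: "h ` carrier G = carrier H"
  shows "has_generalized_torsion H \<longleftrightarrow>
    (\<exists>g hs. g \<in> carrier G \<and> g \<notin> kernel G H h \<and> hs \<noteq> [] \<and> set hs \<subseteq> carrier G \<and>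
      conj_product G g hs \<in> kernel G H h)"
proof
  assume "has_generalized_torsion H"
  then obtain y ys where y: "y \<in> carrier H" "y \<noteq> \<one>\<^bsub>H\<^esub>" "ys \<noteq> []" "set ys \<subseteq> carrier H"
      "conj_product H y ys = \<one>\<^bsub>H\<^esub>"
    by (auto simp: has_generalized_torsion_def generalized_torsion_element_def conj_product_def
        length_greater_0_conv[symmetric] Suc_le_eq simp del: length_greater_0_conv)
  obtain g where g: "g \<in> carrier G" "y = h g"
    using y(1) unfolding surj[symmetric] by blast
  have "ys \<in> lists (h ` carrier G)" using y(4) surj by auto
  then obtain hs where hs: "hs \<in> lists (carrier G)" "ys = map h hs"
    unfolding lists_image by blast
  then have "set hs \<subseteq> carrier G" by auto
  moreover have "g \<notin> kernel G H h" "hs \<noteq> []"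
    using g hs y by (simp_all add: kernel_def)
  moreover have "conj_product G g hs \<in> kernel G H h"
    using hom_conj_product[OF g(1) \<open>set hs \<subseteq> carrier G\<close>] y(5) G.conj_product_closed[OF g(1) \<open>set hs \<subseteq> carrier G\<close>]
    by (simp add: kernel_def g hs)
  ultimately show "\<exists>g hs. g \<in> carrier G \<and> g \<notin> kernel G H h \<and> hs \<noteq> [] \<and> set hs \<subseteq> carrier G \<and>
      conj_product G g hs \<in> kernel G H h"
    using g(1) by blast
next
  assume "\<exists>g hs. g \<in> carrier G \<and> g \<notin> kernel G H h \<and> hs \<noteq> [] \<and> set hs \<subseteq> carrier G \<and>
      conj_product G g hs \<in> kernel G H h"
  then obtain g hs where g: "g \<in> carrier G" "g \<notin> kernel G H h" "hs \<noteq> []" "set hs \<subseteq> carrier G"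
      "conj_product G g hs \<in> kernel G H h" by blast
  have "conj_product H (h g) (map h hs) = \<one>\<^bsub>H\<^esub>"
    using hom_conj_product[OF g(1,4)] g(5) by (simp add: kernel_def)
  moreover have "set (map h hs) \<subseteq> carrier H" using g(4) by auto
  moreover have "length (map h hs) \<ge> 1" using g(3) by (cases hs) auto
  moreover have "h g \<in> carrier H" "h g \<noteq> \<one>\<^bsub>H\<^esub>" using g(1,2) by (auto simp: kernel_def)
  ultimately show "has_generalized_torsion H"
    unfolding has_generalized_torsion_def generalized_torsion_element_def conj_product_def by blast
qed

text \<open>The unit \<open>1 = t\<^sup>0\<close> pairs to \<open>0\<close> with every \<open>chi j\<close> but has odd augmentation.\<close>

lemma relations_0_torsion: "(1 :: laurent) \<notin> relations 0" "(2 :: laurent) \<in> relations 0"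
proof -
  have 1: "pairing \<phi> 1 = \<phi> 0" for \<phi> using pairing_T[of \<phi> 0] by simp
  have 2: "pairing \<phi> 2 = 2 * \<phi> 0" for \<phi>
    using pairing_add[of \<phi> 1 1] by (simp add: 1)
  show "(1 :: laurent) \<notin> relations 0" "(2 :: laurent) \<in> relations 0"
    by (simp_all add: relations_def 1 2)
qed

lemma power_3_not_dvd:
  assumes "q \<noteq> (0 :: int)"
  shows "\<exists>r. \<not> 3 ^ r dvd q"
proof -
  have "nat \<bar>q\<bar> < 3 ^ nat \<bar>q\<bar>" by (rule power_gt_expt) simp
  then have "\<bar>q\<bar> < 3 ^ nat \<bar>q\<bar>" by (simp add: nat_less_iff)
  then have "\<not> 3 ^ nat \<bar>q\<bar> dvd q"
    using dvd_imp_le_int[OF assms, of "3 ^ nat \<bar>q\<bar>"] by auto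
  then show ?thesis ..
qed

text \<open>For odd \<open>i\<close> no \<open>2 m - i\<close> vanishes, so each belongs to exactly one \<open>chi j\<close>, and the parity of the
  augmentation is the parity of the sum of all the pairings.\<close>

lemma relations_odd_iff:
  assumes "odd i"
  shows "c \<in> relations i \<longleftrightarrow> (\<forall>j. pairing (\<lambda>m. chi j (2 * m - i)) c = 0)"
proof
  assume c: "\<forall>j. pairing (\<lambda>m. chi j (2 * m - i)) c = 0"
  have "\<exists>r. \<not> 3 ^ r dvd 2 * m - i" for m :: int
  proof -
    have "2 * m - i \<noteq> 0" using assms by presburger
    then show ?thesis by (rule power_3_not_dvd)
  qed
  then obtain R where R: "\<And>m. \<not> 3 ^ R m dvd 2 * m - i" by metis
  define r where "r = Max (R ` Poly_Mapping.keys c \<union> {0})"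
  have "even (1 + (\<Sum>j<r. chi j (2 * m - i)) :: int)" if m: "m \<in> Poly_Mapping.keys c" for m
  proof -
    have "R m \<le> r" using m by (simp add: r_def)
    obtain v where v: "v < R m" "chi v (2 * m - i) \<noteq> 0" using chi_exists[OF R] .
    have "(\<Sum>j<r. chi j (2 * m - i)) = (\<Sum>j<r. if j = v then chi v (2 * m - i) else 0)"
      by (rule sum.cong) (use chi_unique[OF v(2)] in auto)
    also have "\<dots> = chi v (2 * m - i)" using v(1) \<open>R m \<le> r\<close> by simp
    finally show ?thesis using chi_values[of v "2 * m - i"] v(2) by auto
  qed
  then have "even (pairing (\<lambda>m. 1 + (\<Sum>j<r. chi j (2 * m - i))) c)"
    unfolding pairing_def by (intro dvd_sum) simp
  then show "c \<in> relations i"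
    using c by (simp add: pairing_add_fun pairing_sum relations_def)
qed (simp add: relations_def)

text \<open>The augmentation of a sum of powers of \<open>t\<close> is their number, and \<open>\<int>[t, t\<^sup>-\<^sup>1]\<close> is a domain.\<close>

lemma laurent_positive_times_eq_0:
  assumes "hs \<noteq> []" "(a :: laurent) * (\<Sum>h\<leftarrow>hs. T (f h)) = 0"
  shows "a = 0"
proof -
  have "pairing (\<lambda>_. 1) (\<Sum>h\<leftarrow>hs. T (f h)) = int (length hs)"
    by (induction hs) (simp_all add: pairing_add)
  then have "(\<Sum>h\<leftarrow>hs. T (f h)) \<noteq> 0"
    using assms(1) by (metis length_0_conv of_nat_eq_0_iff pairing_0)
  then show ?thesis using assms(2) by simp
qed

lemma conj_product_n:
  "fst (snd (conj_product mat_group g hs)) = int (length hs) * fst (snd g)"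
proof (induction hs)
  case (Cons h hs)
  have "fst (snd (x \<otimes>\<^bsub>mat_group\<^esub> y)) = fst (snd x) + fst (snd y)" for x y :: mat
    by (cases x, cases y) simp
  moreover have "fst (snd (inv\<^bsub>mat_group\<^esub> h)) = - fst (snd h)" by (cases h) simp
  ultimately show ?case using Cons by (simp add: distrib_right)
qed simp

lemma conj_product_ab:
  "\<exists>c'. conj_product mat_group (a, 0, b, c) hs =
     (a * (\<Sum>h\<leftarrow>hs. T (fst (snd h))), 0, b * (\<Sum>h\<leftarrow>hs. T (- fst (snd h))), c')"
proof (induction hs)
  case (Cons h hs)
  then obtain c' where IH: "conj_product mat_group (a, 0, b, c) hs =
     (a * (\<Sum>h\<leftarrow>hs. T (fst (snd h))), 0, b * (\<Sum>h\<leftarrow>hs. T (- fst (snd h))), c')" ..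
  have "fst (inv\<^bsub>mat_group\<^esub> h \<otimes>\<^bsub>mat_group\<^esub> (a, 0, b, c) \<otimes>\<^bsub>mat_group\<^esub> h) = a * T (fst (snd h))"
       "fst (snd (inv\<^bsub>mat_group\<^esub> h \<otimes>\<^bsub>mat_group\<^esub> (a, 0, b, c) \<otimes>\<^bsub>mat_group\<^esub> h)) = 0"
       "fst (snd (snd (inv\<^bsub>mat_group\<^esub> h \<otimes>\<^bsub>mat_group\<^esub> (a, 0, b, c) \<otimes>\<^bsub>mat_group\<^esub> h))) = b * T (- fst (snd h))"
    by (cases h; simp add: algebra_simps T_mult T_mult_left)+
  then obtain d where "inv\<^bsub>mat_group\<^esub> h \<otimes>\<^bsub>mat_group\<^esub> (a, 0, b, c) \<otimes>\<^bsub>mat_group\<^esub> h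
      = (a * T (fst (snd h)), 0, b * T (- fst (snd h)), d)"
    by (metis prod.collapse)
  then show ?case by (simp add: IH distrib_left add.commute)
qed simp

lemma conj_product_central:
  "conj_product mat_group (0, 0, 0, c) hs = (0, 0, 0, of_nat (length hs) * c)"
proof (induction hs)
  case (Cons h hs)
  then show ?case by (cases h) (simp add: algebra_simps T_mult T_mult_left)
qed simp

lemma conj_product_mem_central:
  assumes "hs \<noteq> []" "conj_product mat_group g hs \<in> central D"
  obtains c where "g = (0, 0, 0, c)" "of_nat (length hs) * c \<in> D"
proof (cases g)
  case (fields a n b c)
  have "n = 0"
    using conj_product_n[of g hs] assms by (auto simp: fields central_def)
  have "a * (\<Sum>h\<leftarrow>hs. T (fst (snd h))) = 0"
       "b * (\<Sum>h\<leftarrow>hs. T (- fst (snd h))) = 0"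
    using conj_product_ab[of a b c hs] assms by (auto simp: fields \<open>n = 0\<close>)
  then have "a = 0" "b = 0"
    by (simp_all only: laurent_positive_times_eq_0[OF assms(1)])
  then show thesis
    using that[of c] assms(2) conj_product_central[of c hs] by (simp add: fields \<open>n = 0\<close>)
qed

section \<open>The two groups\<close>

text \<open>These integers converge to \<open>-1/2\<close> in the \<open>3\<close>-adic integers and to \<open>0\<close> in the \<open>p\<close>-adic ones for
  every other prime \<open>p\<close>.\<close>

definition minus_half :: "nat \<Rightarrow> int" where "minus_half k = (3 ^ fact k - 1) div 2"

lemma two_minus_half: "2 * minus_half k = 3 ^ fact k - 1"
  by (simp add: minus_half_def)

lemma int_split_3:
  assumes "e > (0 :: nat)"
  obtains r e' where "int e = 3 ^ r * e'" "\<not> 3 dvd e'"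
proof -
  obtain e' where "int e = 3 ^ multiplicity 3 (int e) * e'" "\<not> 3 dvd e'"
    by (rule multiplicity_decompose'[of "int e" 3]) (use assms in auto)
  then show thesis by (rule that)
qed

text \<open>With \<open>e = 3\<^sup>r e'\<close>, twice the difference is divisible by \<open>3\<^sup>r\<close> once the factorials reach \<open>r\<close>, and
  by \<open>2 e'\<close> once they are divisible by \<open>\<phi>(2 e')\<close>, by Euler's theorem.\<close>

lemma minus_half_eventually_const:
  assumes "e > (0 :: nat)"
  shows "\<exists>K. \<forall>k\<ge>K. \<forall>l\<ge>K. int e dvd minus_half k - minus_half l"
proof -
  obtain r e' where e: "int e = 3 ^ r * e'" "\<not> 3 dvd e'" by (rule int_split_3[OF assms])
  have e'pos: "e' > 0" using e(1) assms by (metis of_nat_0_less_iff zero_less_mult_pos zero_less_numeral zero_less_power)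
  define u where "u = nat (2 * e')"
  have u: "int u = 2 * e'" using e'pos by (simp add: u_def)
  have "coprime 3 (2 * e')"
    using e(2) prime_imp_coprime[of "3::int" "2 * e'"] by (auto simp: prime_dvd_mult_iff)
  then have cop: "coprime 3 u"
    by (metis coprime_int_iff of_nat_numeral u)
  have "\<forall>k \<ge> max r (totient u). 3 ^ r dvd (3::int) ^ fact k \<and> 2 * e' dvd 3 ^ fact k - 1"
  proof (intro allI impI conjI)
    fix k assume k: "k \<ge> max r (totient u)"
    show "3 ^ r dvd (3::int) ^ fact k"
      using k fact_ge_self[of k] by (intro le_imp_power_dvd) simp
    have "totient u > 0" using e'pos by (simp add: u_def)
    then have "totient u dvd fact k" using k by (intro dvd_fact) (simp_all add: Suc_le_eq)
    then obtain d where d: "fact k = totient u * d" by blast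
    have "[(3 ^ totient u) ^ d = 1 ^ d] (mod u)" by (rule cong_pow[OF euler_theorem[OF cop]])
    then have "[3 ^ fact k = 1] (mod u)" by (simp add: d power_mult)
    then have "[int (3 ^ fact k) = int 1] (mod int u)" by (simp only: cong_int_iff)
    then show "2 * e' dvd 3 ^ fact k - 1" by (simp add: u cong_iff_dvd_diff)
  qed
  then obtain K where K: "\<And>k. k \<ge> K \<Longrightarrow> 3 ^ r dvd (3::int) ^ fact k"
      "\<And>k. k \<ge> K \<Longrightarrow> 2 * e' dvd 3 ^ fact k - 1" by blast
  have "int e dvd minus_half k - minus_half l" if "k \<ge> K" "l \<ge> K" for k l
  proof -
    have 1: "3 ^ r dvd 2 * minus_half k - 2 * minus_half l"
      using dvd_diff[OF K(1)[OF that(1)] K(1)[OF that(2)]] by (simp add: two_minus_half)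
    have 2: "2 * e' dvd 2 * minus_half k - 2 * minus_half l"
      using dvd_diff[OF K(2)[OF that(1)] K(2)[OF that(2)]] by (simp add: two_minus_half)
    have "coprime (3 ^ r) (2 * e')" using \<open>coprime 3 (2 * e')\<close> by simp
    then have "3 ^ r * (2 * e') dvd 2 * minus_half k - 2 * minus_half l" by (rule divides_mult[OF 1 2])
    then have "2 * int e dvd 2 * (minus_half k - minus_half l)" by (simp add: e(1) algebra_simps)
    then show ?thesis by (metis dvd_mult_cancel_left zero_neq_numeral)
  qed
  then show ?thesis by blast
qed

lemma minus_half_3_adic: "\<exists>K. \<forall>k\<ge>K. 3 ^ r dvd 2 * minus_half k + 1"
proof (intro exI allI impI)
  fix k assume "k \<ge> r"
  then show "3 ^ r dvd 2 * minus_half k + 1"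
    using fact_ge_self[of k] by (simp add: two_minus_half le_imp_power_dvd)
qed

text \<open>The central matrices contained in a finite index normal subgroup form a periodic additive
  group, to which \<open>shifted_relations\<close> applies.\<close>

lemma approximate_quotient_map_shift:
  assumes p: "group_hom mat_group G p" "p ` carrier mat_group = carrier G"
      "kernel mat_group G p = central (relations i')"
    and q: "group_hom mat_group H q" "kernel mat_group H q = central (relations i)"
    and const: "\<And>e. e > (0 :: nat) \<Longrightarrow> \<exists>K. \<forall>k\<ge>K. \<forall>l\<ge>K. int e dvd s k - s l"
    and adic: "\<And>r. \<exists>K. \<forall>k\<ge>K. 3 ^ r dvd 2 * s k - i + i'"
  shows "approximate_quotient_map mat_group G H p q (\<lambda>k. shift (s k))"
proof -
  interpret p: group_hom mat_group G p by fact
  interpret q: group_hom mat_group H q by fact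
  show ?thesis
  proof (unfold_locales, goal_cases)
    case 1
    then show ?case by (rule p(2))
  next
    case (2 k)
    then show ?case by (rule shift_hom)
  next
    case (3 N)
    obtain e :: nat where e: "e > 0"
      "\<And>s s' x. int e dvd s - s' \<Longrightarrow> N #>\<^bsub>mat_group\<^esub> shift s x = N #>\<^bsub>mat_group\<^esub> shift s' x"
      by (rule shift_cong_mod[OF 3]) (rule that)
    obtain K where "\<forall>k\<ge>K. \<forall>l\<ge>K. int e dvd s k - s l" using const[OF e(1)] ..
    then show ?case using e(2) by metis
  next
    case (4 N)
    obtain e :: nat where e: "e > 0"
      "\<And>n b. int e dvd n \<Longrightarrow> (0, 0, 0, T n * b - b) \<in> N"
      by (rule finite_index_period[OF 4(1)]) (rule that)
    obtain r e' where re: "int e = 3 ^ r * e'" "\<not> 3 dvd e'" by (rule int_split_3[OF e(1)])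
    obtain K where K: "\<forall>k\<ge>K. 3 ^ r dvd 2 * s k - i + i'" using adic ..
    define A where "A = {c. (0, 0, 0, c) \<in> N}"
    have sub: "subgroup N mat_group" by (rule M.finite_index_normalD(2)[OF 4(1)])
    have A: "diff_closed A"
    proof
      show "0 \<in> A" using subgroup.one_closed[OF sub] by (simp add: A_def)
      fix c d assume "c \<in> A" "d \<in> A"
      then show "c - d \<in> A"
        using subgroup.m_closed[OF sub _ subgroup.m_inv_closed[OF sub], of "(0, 0, 0, c)" "(0, 0, 0, d)"]
        by (simp add: A_def)
    qed
    have per: "T n * b - b \<in> A" if "int e dvd n" for n b
      using e(2)[OF that] by (simp add: A_def)
    have rel: "relations i \<subseteq> A"
      using 4(2) by (auto simp: A_def q(2) central_def)
    have "T (s k) * c \<in> A" if "k \<ge> K" "c \<in> relations i'" for k c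
      by (rule shifted_relations[OF A per re rel K[rule_format, OF that(1)] that(2)])
    then have "\<forall>k\<ge>K. shift (s k) ` kernel mat_group G p \<subseteq> N"
      by (auto simp: p(3) central_def A_def)
    then show ?case ..
  qed
qed

lemma quotient_by_relations:
  obtains G :: "nat monoid" and p where "group_hom mat_group G p" "p ` carrier mat_group = carrier G"
    "kernel mat_group G p = central (relations i)"
    "finitely_generated_group G" "residually_finite_group G"
proof -
  have "countable (UNIV \<times> UNIV \<times> UNIV \<times> UNIV :: mat set)"
    by (intro countable_SIGMA countable_laurent countableI_type)
  then have "countable (carrier mat_group)" by simp
  then obtain G :: "nat monoid" and p where p: "group_hom mat_group G p"
      "p ` carrier mat_group = carrier G" "kernel mat_group G p = central (relations i)"
    by (rule quotient_on_nat[OF group_mat_group central_normal[OF relations.diff_closed_axioms[of i]]])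
  moreover have "finitely_generated_group G"
    by (rule group_hom.finitely_generated_image[OF p(1) _ _ generate_mat_group p(2)]) simp_all
  moreover have "residually_finite_group G"
    by (rule group_hom.residually_finite_image[OF p(1,2)]) (simp add: p(3) separate_central_relations)
  ultimately show thesis by (rule that)
qed

theorem theorem1p3:
  shows "\<not> profinite_property (has_generalized_torsion :: nat monoid \<Rightarrow> bool) \<and>
    (\<exists>(G1 :: nat monoid) (G2 :: nat monoid).
       finitely_generated_group G1 \<and> residually_finite_group G1 \<and>
       finitely_generated_group G2 \<and> residually_finite_group G2 \<and>
       isomorphic_profinite_completions G1 G2 \<and>
       has_generalized_torsion G2 \<and> \<not> has_generalized_torsion G1)"
proof -
  obtain G1 :: "nat monoid" and p where p: "group_hom mat_group G1 p"
      "p ` carrier mat_group = carrier G1" "kernel mat_group G1 p = central (relations 1)"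
    and G1: "finitely_generated_group G1" "residually_finite_group G1"
    by (rule quotient_by_relations)
  obtain G2 :: "nat monoid" and q where q: "group_hom mat_group G2 q"
      "q ` carrier mat_group = carrier G2" "kernel mat_group G2 q = central (relations 0)"
    and G2: "finitely_generated_group G2" "residually_finite_group G2"
    by (rule quotient_by_relations)
  have "approximate_quotient_map mat_group G1 G2 p q (\<lambda>k. shift (minus_half k))"
    by (rule approximate_quotient_map_shift[OF p q(1,3)])
      (use minus_half_eventually_const minus_half_3_adic in simp_all)
  moreover have "approximate_quotient_map mat_group G2 G1 q p (\<lambda>k. shift (- minus_half k))"
  proof (rule approximate_quotient_map_shift[OF q p(1,3)])
    show "\<exists>K. \<forall>k\<ge>K. \<forall>l\<ge>K. int e dvd - minus_half k - - minus_half l" if "e > 0" for e :: nat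
      using minus_half_eventually_const[OF that] by (metis minus_diff_eq diff_minus_eq_add uminus_add_conv_diff dvd_minus_iff)
    show "\<exists>K. \<forall>k\<ge>K. 3 ^ r dvd 2 * - minus_half k - 1 + 0" for r
      using minus_half_3_adic[of r] by (metis add.right_neutral dvd_minus_iff minus_add_distrib mult_minus_right uminus_add_conv_diff diff_conv_add_uminus)
  qed
  ultimately have "isomorphic_profinite_completions G1 G2"
    by (rule isomorphic_completions_of_quotients) (simp_all add: shift_shift)
  moreover have "has_generalized_torsion G2"
  proof -
    have "conj_product mat_group (0, 0, 0, 1) [(0, 0, 0, 0), (0, 0, 0, 0)] \<in> central (relations 0)"
      using relations_0_torsion(2) by (simp add: conj_product_central)
    then show ?thesis
      unfolding group_hom.has_generalized_torsion_image_iff[OF q(1,2)] q(3)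
      using relations_0_torsion(1)
      by (intro exI[of _ "(0, 0, 0, 1)"] exI[of _ "[(0, 0, 0, 0), (0, 0, 0, 0)]"]) simp
  qed
  moreover have "g \<in> central (relations 1)"
    if hs: "hs \<noteq> []" "conj_product mat_group g hs \<in> central (relations 1)" for g hs
  proof -
    obtain c where g: "g = (0, 0, 0, c)" and "of_nat (length hs) * c \<in> relations 1"
      using hs by (rule conj_product_mem_central)
    then have "c \<in> relations 1"
      using hs(1) by (simp add: relations_odd_iff pairing_of_nat_times)
    then show ?thesis by (simp add: g)
  qed
  then have "\<not> has_generalized_torsion G1"
    unfolding group_hom.has_generalized_torsion_image_iff[OF p(1,2)] p(3) by blast
  ultimately show ?thesis
    unfolding profinite_property_def using G1 G2 by blast
qed

end
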